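(* Let $\|\cdot\|_X$ be a norm on $\mathbb{R}^2$ whose unit ball $BX$ is a polygon with finitely many sides, all of which have algebraic slopes. Then there is a compact set $A\subset X$ such that the Hausdorff dimension of $A$ is $2$ and the Lebesgue measure of $\Delta_X(A)$ is $0$.
   Context: $X$ denotes $\mathbb{R}^2$ equipped with the norm $\|\cdot\|_X$, and $BX=\{x:\|x\|_X\le 1\}$. The distance set of $A\subset X$ is $\Delta_X(A)=\{\|a-a'\|_X: a,a'\in A\}\subset\mathbb{R}$. The slope of a non-degenerate segment contained in the line $u_1x_1+u_2x_2+u_0=0$ is $-u_1/u_2$, or $\infty$ if $u_2=0$ (in the standard coordinates of $\mathbb{R}^2$); by convention $\infty$ is considered to be an algebraic number. "Algebraic" means algebraic over $\mathbb{Q}$. *)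

theory Defs
  imports "HOL-Analysis.Analysis" "HOL-Computational_Algebra.Polynomial"
begin

definition is_norm :: "('a::real_vector \<Rightarrow> real) \<Rightarrow> bool" where
  "is_norm N \<longleftrightarrow>
     (\<forall>x. N x = 0 \<longleftrightarrow> x = 0) \<and>
     (\<forall>c x. N (c *\<^sub>R x) = \<bar>c\<bar> * N x) \<and>
     (\<forall>x y. N (x + y) \<le> N x + N y)"

lemma is_norm_nonneg:
  assumes "is_norm N"
  shows "0 \<le> N x"
proof -
  have "N (- 1 *\<^sub>R x) = \<bar>- 1\<bar> * N x" "N (x + - 1 *\<^sub>R x) \<le> N x + N (- 1 *\<^sub>R x)" "N (x + - 1 *\<^sub>R x) = 0"
    using assms unfolding is_norm_def by (blast, blast, simp)
  then show ?thesis by simp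
qed

lemma is_norm_norm: "is_norm (norm :: 'a::real_normed_vector \<Rightarrow> real)"
  by (simp add: is_norm_def norm_triangle_ineq)

definition norm_dist :: "('a::real_vector \<Rightarrow> real) \<Rightarrow> 'a \<Rightarrow> 'a \<Rightarrow> real" where
  "norm_dist N x y = N (x - y)"

lemma Metric_space_norm_dist:
  assumes "is_norm N"
  shows "Metric_space UNIV (norm_dist N)"
proof
  fix x y z
  show "0 \<le> norm_dist N x y"
    by (simp add: norm_dist_def is_norm_nonneg[OF assms])
  have "N (- 1 *\<^sub>R (x - y)) = \<bar>- 1\<bar> * N (x - y)"
    using assms unfolding is_norm_def by blast
  then show "norm_dist N x y = norm_dist N y x"
    by (simp add: norm_dist_def)
  show "norm_dist N x y = 0 \<longleftrightarrow> x = y"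
    using assms by (simp add: norm_dist_def is_norm_def)
  have "N ((x - y) + (y - z)) \<le> N (x - y) + N (y - z)"
    using assms unfolding is_norm_def by blast
  then show "norm_dist N x z \<le> norm_dist N x y + norm_dist N y z"
    by (simp add: norm_dist_def)
qed

definition norm_unit_ball :: "('a::real_vector \<Rightarrow> real) \<Rightarrow> 'a set" where
  "norm_unit_ball N = {x. N x \<le> 1}"

definition distance_set :: "('a::real_vector \<Rightarrow> real) \<Rightarrow> 'a set \<Rightarrow> real set" where
  "distance_set N A = {N (a - a') | a a'. a \<in> A \<and> a' \<in> A}"

definition has_slope :: "(real ^ 2) set \<Rightarrow> ereal \<Rightarrow> bool" where
  "has_slope S m \<longleftrightarrow>
     (\<exists>u0 u1 u2. (u1, u2) \<noteq> (0, 0) \<and>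
        S \<subseteq> {x. u1 * x $ 1 + u2 * x $ 2 + u0 = 0} \<and>
        m = (if u2 = 0 then \<infinity> else ereal (- u1 / u2)))"

text \<open>On sets with at least two points the slope does not depend on the equation
  chosen for the line.\<close>

lemma has_slope_unique:
  assumes "has_slope S m" "has_slope S m'" "a \<in> S" "b \<in> S" "a \<noteq> b"
  shows "m = m'"
proof -
  have ab: "a $ 1 \<noteq> b $ 1 \<or> a $ 2 \<noteq> b $ 2"
    using \<open>a \<noteq> b\<close> by (auto simp: vec_eq_iff forall_2)
  have *: "m = (if a $ 1 = b $ 1 then \<infinity> else ereal ((a $ 2 - b $ 2) / (a $ 1 - b $ 1)))"
    if m: "has_slope S m" for m
  proof -
    obtain u0 u1 u2 where u: "(u1, u2) \<noteq> (0, 0)"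
      "S \<subseteq> {x. u1 * x $ 1 + u2 * x $ 2 + u0 = 0}"
      "m = (if u2 = 0 then \<infinity> else ereal (- u1 / u2))"
      using m unfolding has_slope_def by blast
    have "u1 * a $ 1 + u2 * a $ 2 + u0 = 0" "u1 * b $ 1 + u2 * b $ 2 + u0 = 0"
      using u(2) assms by auto
    then have eq: "u1 * (a $ 1 - b $ 1) + u2 * (a $ 2 - b $ 2) = 0"
      by (simp add: algebra_simps)
    show ?thesis
    proof (cases "u2 = 0")
      case True
      then show ?thesis using eq u by auto
    next
      case False
      then have "a $ 1 \<noteq> b $ 1" using eq ab by auto
      with False eq have "- u1 / u2 = (a $ 2 - b $ 2) / (a $ 1 - b $ 1)"
        by (simp add: divide_simps) (simp add: algebra_simps)
      then show ?thesis using False \<open>a $ 1 \<noteq> b $ 1\<close> u by simp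
    qed
  qed
  show ?thesis using *[OF assms(1)] *[OF assms(2)] by simp
qed

definition algebraic_slope :: "ereal \<Rightarrow> bool" where
  "algebraic_slope m \<longleftrightarrow> m = \<infinity> \<or> (\<exists>r. m = ereal r \<and> algebraic r)"

text \<open>Hausdorff measure and dimension with respect to a distance function \<open>d\<close> on a
  whole type. In \<open>diam_power\<close> the case distinction fixes the conventions that the empty
  set has weight 0 and that a nonempty set has weight 1 in dimension 0
  (note that \<open>0 powr 0 = 0\<close>); it is only applied to sets of finite diameter.\<close>

definition diam :: "('a \<Rightarrow> 'a \<Rightarrow> real) \<Rightarrow> 'a set \<Rightarrow> ennreal" where
  "diam d U = (SUP x\<in>U. SUP y\<in>U. ennreal (d x y))"

definition diam_power :: "('a \<Rightarrow> 'a \<Rightarrow> real) \<Rightarrow> real \<Rightarrow> 'a set \<Rightarrow> ennreal" where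
  "diam_power d s U =
     (if U = {} then 0 else if s = 0 then 1 else ennreal (enn2real (diam d U) powr s))"

definition hausdorff_premeasure ::
    "('a \<Rightarrow> 'a \<Rightarrow> real) \<Rightarrow> real \<Rightarrow> real \<Rightarrow> 'a set \<Rightarrow> ennreal" where
  "hausdorff_premeasure d s \<delta> A =
     (INF U \<in> {U :: nat \<Rightarrow> 'a set. A \<subseteq> (\<Union>i. U i) \<and> (\<forall>i. diam d (U i) \<le> ennreal \<delta>)}.
        \<Sum>i. diam_power d s (U i))"

definition hausdorff_measure :: "('a \<Rightarrow> 'a \<Rightarrow> real) \<Rightarrow> real \<Rightarrow> 'a set \<Rightarrow> ennreal" where
  "hausdorff_measure d s A = (SUP \<delta>\<in>{0<..}. hausdorff_premeasure d s \<delta> A)"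

definition hausdorff_dim :: "('a \<Rightarrow> 'a \<Rightarrow> real) \<Rightarrow> 'a set \<Rightarrow> ereal" where
  "hausdorff_dim d A = Inf (ereal ` {s. 0 \<le> s \<and> hausdorff_measure d s A = 0})"

end

theory Submission
  imports Defs "Jordan_Normal_Form.Determinant"
begin

no_notation vec_index (infixl "$" 100)
no_notation scalar_prod (infix "\<bullet>" 70)

text \<open>On the cone over an edge of its unit ball the norm is a constant multiple of
  \<open>x\<^sub>2 - s x\<^sub>1\<close> or of \<open>x\<^sub>1\<close>, where \<open>s\<close> is the slope of the edge. Hence for a product set
  \<open>A \<times> A\<close> the distances are covered by finitely many scaled copies of the sets
  \<open>(A - A) + s (A - A)\<close>, and it suffices to find a compact \<open>A\<close> on the line for which these are
  null while \<open>A \<times> A\<close> has dimension 2.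

  The slopes generate a number field of some degree \<open>d\<close>. The integer combinations of a basis with
  coefficients in \<open>{0..<T}\<close> form a set of \<open>T\<^sup>d\<close> points in an interval of length \<open>O(T)\<close> that is
  closed under \<open>(D - D) + s (D - D)\<close> up to a constant factor in size, because multiplication by
  \<open>s\<close> has a rational matrix; and a norm estimate shows that its points are separated by
  \<open>c T\<^bsup>1-d\<^esup>\<close>, hence well spaced. The set \<open>A\<close> is a Cantor set whose digit sets are such sets, of
  rapidly growing size; sending a point to the real number with the same digits in the
  corresponding mixed radix expansion gives, for every exponent below 1, a Hoelder map of \<open>A\<close>
  onto the unit interval, which bounds the dimension from below.\<close>

text \<open>For \<open>s = 0\<close> this is the plain difference set of \<open>D\<close>, so
  vertical edges need no separate notion.\<close>

definition dilated_differences :: "real \<Rightarrow> real set \<Rightarrow> real set" where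
  "dilated_differences s D = (\<lambda>(a,b,a',b'). (a - b) + s * (a' - b')) ` (D \<times> D \<times> D \<times> D)"

lemma dilated_differencesI:
  "a \<in> D \<Longrightarrow> b \<in> D \<Longrightarrow> a' \<in> D \<Longrightarrow> b' \<in> D \<Longrightarrow> (a - b) + s * (a' - b') \<in> dilated_differences s D"
  by (auto simp: dilated_differences_def intro!: image_eqI[of _ _ "(a, b, a', b')"])

section \<open>Bases of number fields\<close>

text \<open>The reals as a vector space over the rationals; span and independence then refer to
  rational coefficients.\<close>

definition rat_scale :: "rat \<Rightarrow> real \<Rightarrow> real" where
  "rat_scale q x = of_rat q * x"

interpretation rat_real: vector_space rat_scale
  by standard (auto simp: rat_scale_def algebra_simps of_rat_add of_rat_mult)

text \<open>The span is a finite-dimensional rational algebra inside the reals, so multiplication by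
  any of its elements has a rational matrix.\<close>

definition rat_algebra_gens :: "real set \<Rightarrow> bool" where
  "rat_algebra_gens B \<longleftrightarrow> finite B \<and> 1 \<in> rat_real.span B \<and>
     (\<forall>x\<in>rat_real.span B. \<forall>y\<in>rat_real.span B. x * y \<in> rat_real.span B)"

lemma rat_span_scale: "x \<in> rat_real.span B \<Longrightarrow> of_rat q * x \<in> rat_real.span B"
  using rat_real.span_scale[of x B q] by (simp add: rat_scale_def)

text \<open>For fixed \<open>c\<close> the numbers whose product with \<open>c\<close> lies in the
  span form a subspace, so it is enough to test generators.\<close>

lemma rat_span_mult_right:
  assumes "x \<in> rat_real.span B" "\<And>b. b \<in> B \<Longrightarrow> b * c \<in> rat_real.span C"
  shows "x * c \<in> rat_real.span C"
  using assms(1)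
proof (induction rule: rat_real.span_induct)
  show "rat_real.subspace {x. x * c \<in> rat_real.span C}"
    by (rule rat_real.subspaceI)
       (auto simp: rat_real.span_zero distrib_right rat_scale_def mult.assoc
         intro: rat_real.span_add rat_span_scale)
qed (use assms in auto)

lemma rat_span_mult:
  assumes "x \<in> rat_real.span B" "y \<in> rat_real.span C"
    and "\<And>b c. b \<in> B \<Longrightarrow> c \<in> C \<Longrightarrow> b * c \<in> rat_real.span D"
  shows "x * y \<in> rat_real.span D"
proof (rule rat_span_mult_right[OF assms(1)])
  fix b assume "b \<in> B"
  then have "y * b \<in> rat_real.span D"
    using assms(3)[OF \<open>b \<in> B\<close>] by (intro rat_span_mult_right[OF assms(2)]) (simp add: mult.commute)
  then show "b * y \<in> rat_real.span D" by (simp add: mult.commute)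
qed

text \<open>The products \<open>b * \<alpha> ^ m\<close> with \<open>m\<close> below the degree of a
  polynomial vanishing at \<open>\<alpha>\<close> generate the larger algebra: the polynomial
  rewrites every higher power of \<open>\<alpha>\<close> in terms of lower ones.\<close>

lemma rat_algebra_gens_adjoin:
  assumes B: "rat_algebra_gens B" and "algebraic \<alpha>"
  shows "\<exists>B'. rat_algebra_gens B' \<and> rat_real.span B \<subseteq> rat_real.span B' \<and> \<alpha> \<in> rat_real.span B'"
proof -
  obtain p where p: "\<And>i. Polynomial.coeff p i \<in> \<int>" "p \<noteq> 0" "poly p \<alpha> = 0"
    using \<open>algebraic \<alpha>\<close> unfolding algebraic_def by blast
  define d where "d = degree p"
  obtain k where k: "\<And>i. Polynomial.coeff p i = of_int (k i)" 
  proof -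
    have "\<forall>i. \<exists>k. Polynomial.coeff p i = of_int k" using p(1) by (auto simp: Ints_def)
    from choice[OF this] show ?thesis using that by blast
  qed
  have lead: "k d \<noteq> 0" using p(2) k[of d] unfolding d_def by auto
  define B' where "B' = (\<lambda>(b,m). b * \<alpha> ^ m) ` (B \<times> {..<d})"
  have rel: "\<alpha> ^ d = (\<Sum>i<d. of_rat (- of_int (k i) / of_int (k d)) * \<alpha> ^ i)"
  proof -
    have "poly p \<alpha> = (\<Sum>i<d. of_int (k i) * \<alpha> ^ i) + of_int (k d) * \<alpha> ^ d"
      unfolding poly_altdef d_def[symmetric] lessThan_Suc_atMost[symmetric] by (simp add: k)
    with p(3) have "of_int (k d) * \<alpha> ^ d = - (\<Sum>i<d. of_int (k i) * \<alpha> ^ i)" by linarith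
    then have "\<alpha> ^ d = (\<Sum>i<d. of_int (k i) * \<alpha> ^ i) * (-1 / of_int (k d))"
      using lead by (simp add: field_simps del: sum_negf)
    also have "\<dots> = (\<Sum>i<d. of_rat (- of_int (k i) / of_int (k d)) * \<alpha> ^ i)"
      unfolding sum_distrib_right
      by (rule sum.cong) (auto simp: of_rat_divide of_rat_minus)
    finally show ?thesis .
  qed
  \<comment> \<open>An exponent of at least \<open>d\<close> splits off \<open>\<alpha> ^ d\<close>,
    and \<open>rel\<close> leaves the exponents \<open>n - d + i\<close>, all below
    \<open>n\<close>.\<close>
  have pow: "b * \<alpha> ^ n \<in> rat_real.span B'" if "b \<in> B" for b n
  proof (induction n rule: less_induct)
    case (less n)
    show ?case
    proof (cases "n < d")
      case True
      then show ?thesis using that by (intro rat_real.span_base) (auto simp: B'_def)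
    next
      case False
      then have "b * \<alpha> ^ n = b * \<alpha> ^ (n - d) * \<alpha> ^ d" by (simp flip: power_add)
      also have "\<dots> = (\<Sum>i<d. of_rat (- of_int (k i) / of_int (k d)) * (b * \<alpha> ^ (n - d + i)))"
        unfolding rel sum_distrib_left by (rule sum.cong) (auto simp: power_add)
      finally show ?thesis
        using False by (auto intro!: rat_real.span_sum rat_span_scale less.IH)
    qed
  qed
  have pow': "x * \<alpha> ^ n \<in> rat_real.span B'" if "x \<in> rat_real.span B" for x n
    using that pow by (rule rat_span_mult_right)
  have sub: "rat_real.span B \<subseteq> rat_real.span B'" using pow'[of _ 0] by auto
  have one: "1 \<in> rat_real.span B" using B by (simp add: rat_algebra_gens_def)
  have "x * y \<in> rat_real.span B'" if "x \<in> rat_real.span B'" "y \<in> rat_real.span B'" for x y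
  proof (rule rat_span_mult[OF that])
    fix u v assume "u \<in> B'" "v \<in> B'"
    then obtain b m b' m' where u: "u = b * \<alpha> ^ m" "v = b' * \<alpha> ^ m'" "b \<in> B" "b' \<in> B"
      by (auto simp: B'_def)
    then have "b * b' \<in> rat_real.span B"
      using B by (simp add: rat_algebra_gens_def rat_real.span_base)
    from pow'[OF this, of "m + m'"] show "u * v \<in> rat_real.span B'"
      by (simp add: u power_add mult_ac)
  qed
  then have "rat_algebra_gens B'"
    using B one sub by (auto simp: rat_algebra_gens_def B'_def)
  then show ?thesis using sub pow'[OF one, of 1] by auto
qed

lemma rat_algebra_gens_exists:
  assumes "finite S" "\<And>s. s \<in> S \<Longrightarrow> algebraic s"
  shows "\<exists>B. rat_algebra_gens B \<and> S \<subseteq> rat_real.span B"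
  using assms
proof (induction rule: finite_induct)
  case empty
  have "rat_algebra_gens {1}"
    using rat_span_mult[where B="{1}" and C="{1}" and D="{1}"]
    by (auto simp: rat_algebra_gens_def rat_real.span_base)
  then show ?case by blast
next
  case (insert s S)
  then obtain B where B: "rat_algebra_gens B" "S \<subseteq> rat_real.span B" by auto
  obtain B' where "rat_algebra_gens B'" "rat_real.span B \<subseteq> rat_real.span B'" "s \<in> rat_real.span B'"
    using rat_algebra_gens_adjoin[OF B(1)] insert.prems by blast
  with B(2) show ?case by (intro exI[of _ B']) auto
qed

text \<open>Apart from finiteness the property depends on the span alone, so a maximal independent
  subset of a generating set inherits it.\<close>

lemma rat_algebra_basis_exists:
  assumes "finite S" "\<And>s. s \<in> S \<Longrightarrow> algebraic s"
  shows "\<exists>B. rat_algebra_gens B \<and> rat_real.independent B \<and> S \<subseteq> rat_real.span B"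
proof -
  obtain B where B: "rat_algebra_gens B" "S \<subseteq> rat_real.span B"
    using rat_algebra_gens_exists[OF assms] by auto
  obtain B0 where B0: "B0 \<subseteq> B" "rat_real.independent B0" "B \<subseteq> rat_real.span B0"
    using rat_real.maximal_independent_subset by blast
  then have "rat_real.span B0 = rat_real.span B"
    by (intro subset_antisym rat_real.span_mono rat_real.span_minimal rat_real.subspace_span)
  with B B0 show ?thesis 
    by (intro exI[of _ B0]) (auto simp: rat_algebra_gens_def intro: finite_subset)
qed

section \<open>Common denominators and integral bases\<close>

lemma rat_common_denominator:
  assumes "finite (R :: rat set)"
  shows "\<exists>q::int. q > 0 \<and> (\<forall>r\<in>R. \<exists>k::int. of_int q * r = of_int k)"
  using assms
proof (induction rule: finite_induct)
  case (insert r R)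
  then obtain q where q: "q > 0" "\<forall>r\<in>R. \<exists>k::int. of_int q * r = of_int k" by auto
  obtain a b where ab: "r = Rat.Fract a b" "b > 0" by (cases r) auto
  have "\<exists>k::int. of_int (q * b) * r' = of_int k" if r': "r' \<in> insert r R" for r'
  proof (cases "r' = r")
    case True
    then have "of_int (q * b) * r' = of_int (q * a)"
      using ab by (simp add: Fract_of_int_quotient)
    then show ?thesis by blast
  next
    case False
    then obtain k where "of_int q * r' = of_int k" using q r' by auto
    then have "of_int (q * b) * r' = of_int (k * b)" by (simp add: mult_ac)
    then show ?thesis by blast
  qed
  then show ?case using q ab by (intro exI[of _ "q * b"]) auto
qed (auto intro: exI[of _ 1])

lemma rat_span_common_denominator:
  assumes "finite B" "finite X" "X \<subseteq> rat_real.span B"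
  shows "\<exists>(q::int) a. q > 0 \<and> (\<forall>x\<in>X. of_int q * x = (\<Sum>b\<in>B. of_int (a x b) * b))"
proof -
  have "\<forall>x\<in>X. \<exists>u. x = (\<Sum>b\<in>B. of_rat (u b) * b)"
    using assms(3) unfolding rat_real.span_finite[OF assms(1)] rat_scale_def by auto
  from bchoice[OF this] obtain u where u: "\<And>x. x \<in> X \<Longrightarrow> x = (\<Sum>b\<in>B. of_rat (u x b) * b)"
    by auto
  obtain q :: int where q: "q > 0"
      "\<forall>r\<in>(\<lambda>(x,b). u x b) ` (X \<times> B). \<exists>k::int. of_int q * r = of_int k"
    using rat_common_denominator[of "(\<lambda>(x,b). u x b) ` (X \<times> B)"] assms by auto
  then have *: "\<forall>x\<in>X. \<forall>b\<in>B. \<exists>k::int. of_int q * u x b = of_int k" by auto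
  then obtain a where a: "\<And>x b. x \<in> X \<Longrightarrow> b \<in> B \<Longrightarrow> of_int q * u x b = of_int (a x b)"
  proof -
    have "\<forall>p\<in>X \<times> B. \<exists>k::int. of_int q * u (fst p) (snd p) = of_int k" using * by auto
    from bchoice[OF this] show ?thesis using that[of "\<lambda>x b. _ (x, b)"] by force
  qed
  have "of_int q * x = (\<Sum>b\<in>B. of_int (a x b) * b)" if "x \<in> X" for x
  proof -
    have "of_int q * x = (\<Sum>b\<in>B. of_rat (of_int q * u x b) * b)"
      by (subst u[OF that]) (simp add: sum_distrib_left of_rat_mult mult_ac)
    also have "\<dots> = (\<Sum>b\<in>B. of_int (a x b) * b)"
      by (rule sum.cong) (auto simp: a that)
    finally show ?thesis .
  qed
  then show ?thesis using q(1) by blast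
qed

text \<open>The \<open>e i\<close> are linearly independent over the rationals, stated with integer
  coefficients since denominators can be cleared; \<open>c\<close> holds their multiplication table
  scaled by \<open>q\<close>.\<close>

definition integral_basis :: "nat \<Rightarrow> (nat \<Rightarrow> real) \<Rightarrow> int \<Rightarrow> (nat \<Rightarrow> nat \<Rightarrow> nat \<Rightarrow> int) \<Rightarrow> bool" where
  "integral_basis d e q c \<longleftrightarrow> d > 0 \<and> q > 0 \<and>
     (\<forall>u::nat \<Rightarrow> int. (\<Sum>i<d. of_int (u i) * e i) = 0 \<longrightarrow> (\<forall>i<d. u i = 0)) \<and>
     (\<forall>i<d. \<forall>j<d. of_int q * (e i * e j) = (\<Sum>l<d. of_int (c i j l) * e l))"

lemma algebraic_integral_basis:
  assumes "finite S" "\<And>s. s \<in> S \<Longrightarrow> algebraic s"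
  obtains d e q c and a :: "real \<Rightarrow> nat \<Rightarrow> nat \<Rightarrow> int"
  where "integral_basis d e q c"
    "\<forall>s\<in>S. \<forall>j<d. of_int q * (s * e j) = (\<Sum>l<d. of_int (a s j l) * e l)"
proof -
  obtain B where B: "rat_algebra_gens B" "rat_real.independent B" "S \<subseteq> rat_real.span B"
    using rat_algebra_basis_exists[OF assms] by blast
  then have fin: "finite B" by (simp add: rat_algebra_gens_def)
  define d where "d = card B"
  obtain e where e: "bij_betw e {..<d} B"
    using ex_bij_betw_nat_finite[OF fin] by (auto simp: d_def atLeast0LessThan)
  have eB: "e i \<in> B" if "i < d" for i using e that by (auto simp: bij_betw_def)
  have sum_e: "(\<Sum>b\<in>B. f b * b) = (\<Sum>i<d. f (e i) * e i)" for f :: "real \<Rightarrow> real"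
    by (rule sum.reindex_bij_betw[OF e, symmetric])
  have ind: "\<forall>i<d. u i = 0" if "(\<Sum>i<d. of_int (u i) * e i) = 0" for u :: "nat \<Rightarrow> int"
  proof -
    define v where "v b = rat_of_int (u (inv_into {..<d} e b))" for b
    have "(\<Sum>b\<in>B. of_rat (v b) * b) = (\<Sum>i<d. of_int (u i) * e i)"
      unfolding sum_e
      by (rule sum.cong) (use e in \<open>auto simp: v_def bij_betw_def inv_into_f_f\<close>)
    with that have "\<forall>b\<in>B. v b = 0"
      using B(2) fin unfolding rat_real.dependent_finite[OF fin] rat_scale_def by auto
    then show ?thesis using e eB by (fastforce simp: v_def bij_betw_def inv_into_f_f)
  qed
  have "B \<noteq> {}"
    using B(1) by (auto simp: rat_algebra_gens_def)
  then have d0: "d > 0" using fin by (simp add: d_def card_gt_0_iff)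
  \<comment> \<open>One denominator \<open>q\<close> has to serve both the multiplication table of
    the basis and the matrices of all elements of \<open>S\<close>.\<close>
  define X where "X = (\<lambda>(x,y). x * y) ` ((B \<union> S) \<times> B)"
  have "finite X" using fin assms(1) by (simp add: X_def)
  moreover have "X \<subseteq> rat_real.span B"
    using B by (auto simp: X_def rat_algebra_gens_def rat_real.span_base subset_iff)
  ultimately obtain q :: int and w where
    q: "q > 0" "\<forall>x\<in>X. of_int q * x = (\<Sum>b\<in>B. of_int (w x b) * b)"
    using rat_span_common_denominator[OF fin] by blast
  have w: "of_int q * x = (\<Sum>l<d. of_int (w x (e l)) * e l)" if "x \<in> X" for x
    using q(2) that by (simp add: sum_e)
  show thesis
  proof (rule that)
    have "of_int q * (e i * e j) = (\<Sum>l<d. of_int (w (e i * e j) (e l)) * e l)"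
      if "i < d" "j < d" for i j
      using that by (intro w) (auto simp: X_def intro!: image_eqI[of _ _ "(e i, e j)"] eB)
    with d0 q(1) ind show "integral_basis d e q (\<lambda>i j l. w (e i * e j) (e l))"
      by (simp add: integral_basis_def)
    show "\<forall>s\<in>S. \<forall>j<d. of_int q * (s * e j) = (\<Sum>l<d. of_int (w (s * e j) (e l)) * e l)"
      by (intro ballI allI impI w) (auto simp: X_def intro!: image_eqI[of _ _ "(_, e _)"] eB)
  qed
qed

section \<open>Lower bounds for integer combinations\<close>

lemma abs_det_le:
  fixes M :: "int mat"
  assumes M: "M \<in> carrier_mat n n" and "\<And>i j. i < n \<Longrightarrow> j < n \<Longrightarrow> real_of_int \<bar>M $$ (i,j)\<bar> \<le> b"
  shows "real_of_int \<bar>Determinant.det M\<bar> \<le> fact n * b ^ n"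
proof -
  let ?P = "{p. p permutes {0..<n}}"
  have fin: "finite ?P" by (simp add: finite_permutations)
  \<comment> \<open>Leibniz formula: \<open>fact n\<close> permutations, each with a product bounded
    by \<open>b ^ n\<close>.\<close>
  have "real_of_int \<bar>Determinant.det M\<bar> =
      \<bar>\<Sum>p\<in>?P. real_of_int (signof p * (\<Prod>i = 0..<n. M $$ (i, p i)))\<bar>"
    by (simp add: det_def'[OF M])
  also have "\<dots> \<le> (\<Sum>p\<in>?P. \<bar>real_of_int (signof p * (\<Prod>i = 0..<n. M $$ (i, p i)))\<bar>)"
    by (rule sum_abs)
  also have "\<dots> \<le> (\<Sum>p\<in>?P. b ^ n)"
  proof (rule sum_mono)
    fix p assume "p \<in> ?P"
    then have p: "p i < n" if "i < n" for i
      using permutes_in_image[of p "{0..<n}" i] that by auto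
    have "\<bar>real_of_int (signof p * (\<Prod>i = 0..<n. M $$ (i, p i)))\<bar> =
        (\<Prod>i = 0..<n. real_of_int \<bar>M $$ (i, p i)\<bar>)"
      by (simp add: abs_mult sign_def prod.distrib flip: abs_prod)
    also have "\<dots> \<le> (\<Prod>i = 0..<n. b)"
      by (rule prod_mono) (use assms(2) p in auto)
    finally show "\<bar>real_of_int (signof p * (\<Prod>i = 0..<n. M $$ (i, p i)))\<bar> \<le> b ^ n" by simp
  qed
  also have "\<dots> = fact n * b ^ n"
    using card_permutations[of "{0..<n}" n] by simp
  finally show ?thesis .
qed

text \<open>Multiplication by \<open>x = \<Sum> u\<^sub>i e\<^sub>i\<close> has, up to the factor \<open>q\<close>, an integer matrix in the basis
  \<open>e\<close>; its determinant is a nonzero integer, and Cramer's rule turns this into a lower bound for \<open>x\<close>.\<close>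

lemma integral_basis_lower_bound:
  assumes basis: "integral_basis d e q c"
  obtains \<kappa> where "\<kappa> > 0"
    "\<forall>(u::nat \<Rightarrow> int) T. 1 \<le> T \<longrightarrow> (\<forall>i<d. \<bar>of_int (u i)\<bar> \<le> T) \<longrightarrow> (\<exists>i<d. u i \<noteq> 0)
       \<longrightarrow> \<kappa> / T ^ (d - 1) \<le> \<bar>\<Sum>i<d. of_int (u i) * e i\<bar>"
proof -
  have "d > 0" "q > 0"
    and ind: "\<And>u::nat \<Rightarrow> int. (\<Sum>i<d. of_int (u i) * e i) = 0 \<Longrightarrow> \<forall>i<d. u i = 0"
    and mult: "\<And>i j. i < d \<Longrightarrow> j < d \<Longrightarrow> of_int q * (e i * e j) = (\<Sum>l<d. of_int (c i j l) * e l)"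
    using basis by (auto simp: integral_basis_def)
  have e0: "e 0 \<noteq> 0"
  proof
    assume "e 0 = 0"
    then have "(\<Sum>i<d. of_int (if i = 0 then 1 else 0) * e i) = 0"
      by (intro sum.neutral) auto
    from ind[OF this] \<open>d > 0\<close> show False by auto
  qed
  define E where "E = (\<Sum>j<d. \<bar>e j\<bar>)"
  have "\<bar>e 0\<bar> \<le> E" unfolding E_def using \<open>d > 0\<close> by (intro member_le_sum) auto
  with e0 have E: "E > 0" by linarith
  \<comment> \<open>Bounds the sum over \<open>i\<close> of \<open>\<bar>c i j l\<bar>\<close> for
    all \<open>j\<close> and \<open>l\<close>; the added 1 keeps it positive, since it becomes a
    divisor.\<close>
  define K where "K = 1 + (\<Sum>i<d. \<Sum>j<d. \<Sum>l<d. \<bar>real_of_int (c i j l)\<bar>)"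
  have K: "(\<Sum>i<d. \<bar>real_of_int (c i j l)\<bar>) \<le> K" if "j < d" "l < d" for j l
  proof -
    have "(\<Sum>i<d. \<bar>real_of_int (c i j l)\<bar>) \<le> (\<Sum>i<d. \<Sum>j<d. \<Sum>l<d. \<bar>real_of_int (c i j l)\<bar>)"
    proof (rule sum_mono)
      fix i
      have "\<bar>real_of_int (c i j l)\<bar> \<le> (\<Sum>l<d. \<bar>real_of_int (c i j l)\<bar>)"
        by (intro member_le_sum) (use that in auto)
      also have "\<dots> \<le> (\<Sum>j<d. \<Sum>l<d. \<bar>real_of_int (c i j l)\<bar>)"
        using that by (intro member_le_sum[of j _ "\<lambda>j. \<Sum>l<d. \<bar>real_of_int (c i j l)\<bar>"]) (auto intro: sum_nonneg)
      finally show "\<bar>real_of_int (c i j l)\<bar> \<le> (\<Sum>j<d. \<Sum>l<d. \<bar>real_of_int (c i j l)\<bar>)" .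
    qed
    then show ?thesis by (simp add: K_def)
  qed
  have "K \<ge> 1" by (simp add: K_def sum_nonneg)
  \<comment> \<open>Read off from the final estimate, in which each cofactor costs
    \<open>fact (d - 1) * (K * T) ^ (d - 1)\<close> and \<open>E\<close> collects the basis.\<close>
  define \<kappa> where "\<kappa> = \<bar>e 0\<bar> / (of_int q * fact (d - 1) * K ^ (d - 1) * E)"
  have "\<kappa> > 0" using e0 E \<open>K \<ge> 1\<close> \<open>q > 0\<close> by (simp add: \<kappa>_def)
  moreover have "\<kappa> / T ^ (d - 1) \<le> \<bar>\<Sum>i<d. of_int (u i) * e i\<bar>"
    if T: "1 \<le> T" and u: "\<And>i. i < d \<Longrightarrow> \<bar>of_int (u i)\<bar> \<le> T" and u0: "\<exists>i<d. u i \<noteq> 0"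
    for u :: "nat \<Rightarrow> int" and T :: real
  proof -
    define x where "x = (\<Sum>i<d. of_int (u i) * e i)"
    have "x \<noteq> 0" using ind[of u] u0 by (auto simp: x_def)
    \<comment> \<open>Row \<open>j\<close> holds the coordinates of \<open>q * x * e j\<close>, so
      \<open>A\<close> is the integer matrix of multiplication by \<open>q * x\<close>.\<close>
    define A where "A = Matrix.mat d d (\<lambda>(j,l). \<Sum>i<d. u i * c i j l)"
    have A: "A \<in> carrier_mat d d" by (simp add: A_def)
    have xe: "of_int q * x * e j = (\<Sum>l<d. of_int (A $$ (j,l)) * e l)" if "j < d" for j
    proof -
      have "of_int q * x * e j = (\<Sum>i<d. of_int (u i) * (of_int q * (e i * e j)))"
        by (simp add: x_def sum_distrib_left sum_distrib_right mult_ac)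
      also have "\<dots> = (\<Sum>i<d. \<Sum>l<d. of_int (u i * c i j l) * e l)"
        by (rule sum.cong) (auto simp: mult that sum_distrib_left mult_ac)
      also have "\<dots> = (\<Sum>l<d. \<Sum>i<d. of_int (u i * c i j l) * e l)"
        by (rule sum.swap)
      also have "\<dots> = (\<Sum>l<d. of_int (A $$ (j,l)) * e l)"
        by (rule sum.cong) (auto simp: A_def that sum_distrib_right)
      finally show ?thesis .
    qed
    have A_le: "real_of_int \<bar>A $$ (j,l)\<bar> \<le> K * T" if "j < d" "l < d" for j l
    proof -
      have "real_of_int \<bar>A $$ (j,l)\<bar> = \<bar>\<Sum>i<d. of_int (u i) * of_int (c i j l)\<bar>"
        using that by (simp add: A_def)
      also have "\<dots> \<le> (\<Sum>i<d. \<bar>of_int (u i)\<bar> * \<bar>of_int (c i j l)\<bar>)"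
        by (rule order_trans[OF sum_abs]) (simp add: abs_mult)
      also have "\<dots> \<le> (\<Sum>i<d. T * \<bar>of_int (c i j l)\<bar>)"
        by (intro sum_mono mult_right_mono u) auto
      also have "\<dots> \<le> T * K"
        using K[OF that] T by (simp flip: sum_distrib_left)
      finally show ?thesis by (simp add: mult.commute)
    qed
    \<comment> \<open>An integer vector \<open>v\<close> killed by the transpose makes the product
      of \<open>q * x\<close> and the combination of the \<open>e j\<close> with coefficients
      \<open>v\<close> vanish; as \<open>x \<noteq> 0\<close>, independence forces
      \<open>v = 0\<close>.\<close>
    have det: "Determinant.det A \<noteq> 0"
    proof
      assume "Determinant.det A = 0"
      then have "Determinant.det A\<^sup>T = 0" using det_transpose[OF A] by simp
      moreover have At: "A\<^sup>T \<in> carrier_mat d d" using A by simp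
      ultimately obtain v where v: "v \<in> carrier_vec d" "v \<noteq> 0\<^sub>v d" "A\<^sup>T *\<^sub>v v = 0\<^sub>v d"
        using det_0_iff_vec_prod_zero by blast
      have v0: "(\<Sum>j<d. A $$ (j,l) * vec_index v j) = 0" if "l < d" for l
      proof -
        have "vec_index (A\<^sup>T *\<^sub>v v) l = 0" using v(3) that by simp
        then show ?thesis
          using that A v(1) by (simp add: scalar_prod_def atLeast0LessThan)
      qed
      have "of_int q * x * (\<Sum>j<d. of_int (vec_index v j) * e j) =
          (\<Sum>j<d. of_int (vec_index v j) * (of_int q * x * e j))"
        by (simp add: sum_distrib_left mult_ac)
      also have "\<dots> = (\<Sum>j<d. \<Sum>l<d. of_int (A $$ (j,l) * vec_index v j) * e l)"
        by (intro sum.cong refl, subst xe) (auto simp: sum_distrib_left mult_ac)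
      also have "\<dots> = (\<Sum>l<d. \<Sum>j<d. of_int (A $$ (j,l) * vec_index v j) * e l)"
        by (rule sum.swap)
      also have "\<dots> = (\<Sum>l<d. of_int (\<Sum>j<d. A $$ (j,l) * vec_index v j) * e l)"
        by (simp add: sum_distrib_right)
      also have "\<dots> = 0"
        by (intro sum.neutral) (auto simp only: v0 lessThan_iff of_int_0 mult_zero_left)
      finally have "(\<Sum>j<d. of_int (vec_index v j) * e j) = 0"
        using \<open>x \<noteq> 0\<close> \<open>q > 0\<close> by simp
      from ind[OF this] v(1,2) show False by auto
    qed
    \<comment> \<open>The first row of the adjugate isolates \<open>e 0\<close>: multiplying the
      relations \<open>xe\<close> by \<open>w j\<close> and summing leaves
      \<open>det A * e 0\<close>.\<close>
    define w where "w j = adj_mat A $$ (0, j)" for j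
    have w_le: "real_of_int \<bar>w j\<bar> \<le> fact (d - 1) * (K * T) ^ (d - 1)" if "j < d" for j
    proof -
      have "\<bar>w j\<bar> = \<bar>Determinant.det (mat_delete A j 0)\<bar>"
        using that A \<open>d > 0\<close> by (simp add: w_def adj_mat_def cofactor_def abs_mult power_abs)
      moreover have "real_of_int \<bar>Determinant.det (mat_delete A j 0)\<bar> \<le> fact (d - 1) * (K * T) ^ (d - 1)"
        by (rule abs_det_le) (use A A_le that in \<open>auto simp: mat_delete_def\<close>)
      ultimately show ?thesis by simp
    qed
    have wA: "(\<Sum>j<d. w j * A $$ (j,l)) = (if l = 0 then Determinant.det A else 0)" if "l < d" for l
    proof -
      have "(adj_mat A * A) $$ (0, l) = (\<Sum>j<d. w j * A $$ (j,l))"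
        using that A adj_mat(1)[OF A] \<open>d > 0\<close>
        by (simp add: w_def scalar_prod_def atLeast0LessThan)
      then show ?thesis using adj_mat(3)[OF A] that \<open>d > 0\<close> by auto
    qed
    have "of_int q * x * (\<Sum>j<d. of_int (w j) * e j) = (\<Sum>j<d. of_int (w j) * (of_int q * x * e j))"
      by (simp add: sum_distrib_left mult_ac)
    also have "\<dots> = (\<Sum>j<d. \<Sum>l<d. of_int (w j * A $$ (j,l)) * e l)"
      by (intro sum.cong refl, subst xe) (auto simp: sum_distrib_left mult_ac)
    also have "\<dots> = (\<Sum>l<d. \<Sum>j<d. of_int (w j * A $$ (j,l)) * e l)"
      by (rule sum.swap)
    also have "\<dots> = (\<Sum>l<d. of_int (\<Sum>j<d. w j * A $$ (j,l)) * e l)"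
      by (simp add: sum_distrib_right)
    also have "\<dots> = (\<Sum>l<d. if l = 0 then of_int (Determinant.det A) * e 0 else 0)"
      by (rule sum.cong) (auto simp del: of_int_sum simp: wA)
    also have "\<dots> = of_int (Determinant.det A) * e 0"
      using \<open>d > 0\<close> by simp
    finally have eq: "of_int q * x * (\<Sum>j<d. of_int (w j) * e j) = of_int (Determinant.det A) * e 0" .
    \<comment> \<open>Here integrality pays off: a nonzero integer has absolute value at least
      1.\<close>
    have "1 \<le> \<bar>Determinant.det A\<bar>" using det by linarith
    then have "1 \<le> \<bar>real_of_int (Determinant.det A)\<bar>" by linarith
    from mult_right_mono[OF this, of "\<bar>e 0\<bar>"]
    have "\<bar>e 0\<bar> \<le> \<bar>real_of_int (Determinant.det A)\<bar> * \<bar>e 0\<bar>" by simp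
    also have "\<dots> = of_int q * \<bar>x\<bar> * \<bar>\<Sum>j<d. of_int (w j) * e j\<bar>"
      using arg_cong[OF eq, of abs] \<open>q > 0\<close> by (simp add: abs_mult)
    finally have e0_le: "\<bar>e 0\<bar> \<le> of_int q * \<bar>x\<bar> * \<bar>\<Sum>j<d. of_int (w j) * e j\<bar>" .
    have "\<bar>\<Sum>j<d. of_int (w j) * e j\<bar> \<le> (\<Sum>j<d. \<bar>of_int (w j)\<bar> * \<bar>e j\<bar>)"
      by (rule order_trans[OF sum_abs]) (simp add: abs_mult)
    also have "\<dots> \<le> (\<Sum>j<d. (fact (d - 1) * (K * T) ^ (d - 1)) * \<bar>e j\<bar>)"
      using w_le by (intro sum_mono mult_right_mono) auto
    also have "\<dots> = fact (d - 1) * (K * T) ^ (d - 1) * E"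
      by (simp add: E_def sum_distrib_left)
    finally have "of_int q * \<bar>x\<bar> * \<bar>\<Sum>j<d. of_int (w j) * e j\<bar> \<le>
        of_int q * \<bar>x\<bar> * (fact (d - 1) * (K * T) ^ (d - 1) * E)"
      using \<open>q > 0\<close> by (intro mult_left_mono) auto
    with e0_le have "\<bar>e 0\<bar> \<le> of_int q * \<bar>x\<bar> * (fact (d - 1) * (K * T) ^ (d - 1) * E)"
      by linarith
    then show ?thesis
      using T E \<open>K \<ge> 1\<close> \<open>q > 0\<close>
      by (simp add: \<kappa>_def x_def divide_simps power_mult_distrib mult_ac)
  qed
  ultimately show ?thesis by (intro that[of \<kappa>]) blast+
qed

text \<open>\<open>D\<close> consists of the integer combinations with coefficients in
  \<open>{0..<T}\<close>, moved affinely into the unit interval: \<open>T ^ d\<close> points whose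
  mutual distances are at least of order \<open>1 / T ^ d\<close>. Multiplied by \<open>q\<close>,
  its dilated differences are rescaled integer combinations with coefficients of order
  \<open>T\<close>, so their number is of order \<open>T ^ d\<close> as well. Neither constant
  depends on \<open>n0\<close>.\<close>

lemma separated_set_few_dilated_differences:
  assumes "finite S" "\<And>s. s \<in> S \<Longrightarrow> algebraic s"
  obtains c C :: real where "0 < c" "c \<le> 1"
    "\<And>n0::nat. \<exists>D::real set. finite D \<and> D \<subseteq> {0..1} \<and> n0 \<le> card D \<and>
       (\<forall>x\<in>D. \<forall>y\<in>D. x \<noteq> y \<longrightarrow> c / card D \<le> \<bar>x - y\<bar>) \<and>
       (\<forall>s\<in>S. card (dilated_differences s D) \<le> C * card D)"
proof -
  obtain d e q c a where basis: "integral_basis d e q c"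
    and a: "\<forall>s\<in>S. \<forall>j<d. of_int q * (s * e j) = (\<Sum>l<d. of_int (a s j l) * e l)"
    by (rule algebraic_integral_basis[OF assms])
  have d: "d > 0" and q: "q > 0"
    and ind: "\<And>u::nat \<Rightarrow> int. (\<Sum>i<d. of_int (u i) * e i) = 0 \<Longrightarrow> \<forall>i<d. u i = 0"
    using basis by (auto simp: integral_basis_def)
  obtain \<kappa> where \<kappa>: "\<kappa> > 0"
    "\<forall>(u::nat \<Rightarrow> int) T. 1 \<le> T \<longrightarrow> (\<forall>i<d. \<bar>of_int (u i)\<bar> \<le> T) \<longrightarrow> (\<exists>i<d. u i \<noteq> 0)
       \<longrightarrow> \<kappa> / T ^ (d - 1) \<le> \<bar>\<Sum>i<d. of_int (u i) * e i\<bar>"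
    by (rule integral_basis_lower_bound[OF basis])
  define M where "M = (\<Sum>i<d. \<bar>e i\<bar>)"
  have "M \<noteq> 0"
  proof
    assume "M = 0"
    then have "\<forall>i<d. e i = 0" by (auto simp: M_def sum_nonneg_eq_0_iff)
    then have "(\<Sum>i<d. of_int 1 * e i) = 0" by simp
    from ind[OF this] d show False by auto
  qed
  moreover have "M \<ge> 0" by (simp add: M_def sum_nonneg)
  ultimately have M: "M > 0" by linarith
  \<comment> \<open>Times \<open>T\<close>, this bounds all coefficients of the dilated differences
    scaled by \<open>q\<close>, for every \<open>s\<close> in \<open>S\<close> at once.\<close>
  define H where "H = q + (\<Sum>s\<in>S. \<Sum>j<d. \<Sum>l<d. \<bar>a s j l\<bar>)"
  have H: "q + (\<Sum>j<d. \<bar>a s j l\<bar>) \<le> H" if "s \<in> S" "l < d" for s l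
  proof -
    have "(\<Sum>j<d. \<bar>a s j l\<bar>) \<le> (\<Sum>j<d. \<Sum>l<d. \<bar>a s j l\<bar>)"
      by (intro sum_mono member_le_sum) (use that in auto)
    also have "\<dots> \<le> (\<Sum>s\<in>S. \<Sum>j<d. \<Sum>l<d. \<bar>a s j l\<bar>)"
      using that assms(1) by (intro member_le_sum[of s _ "\<lambda>s. \<Sum>j<d. \<Sum>l<d. \<bar>a s j l\<bar>"]) (auto intro: sum_nonneg)
    finally show ?thesis by (simp add: H_def)
  qed
  have "(\<Sum>s\<in>S. \<Sum>j<d. \<Sum>l<d. \<bar>a s j l\<bar>) \<ge> 0" by (intro sum_nonneg) auto
  then have H1: "H \<ge> 1" using q by (simp add: H_def)
  \<comment> \<open>The gap \<open>\<kappa> / T ^ (d - 1)\<close> gets divided by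
    \<open>2 * M * T\<close>, the length of the original interval; the minimum with 1 serves the
    Cantor construction.\<close>
  define c0 where "c0 = min 1 (\<kappa> / (2 * M))"
  have "c0 > 0" "c0 \<le> 1" using \<kappa>(1) M by (auto simp: c0_def)
  moreover have "\<exists>D::real set. finite D \<and> D \<subseteq> {0..1} \<and> n0 \<le> card D \<and>
       (\<forall>x\<in>D. \<forall>y\<in>D. x \<noteq> y \<longrightarrow> c0 / card D \<le> \<bar>x - y\<bar>) \<and>
       (\<forall>s\<in>S. card (dilated_differences s D) \<le> (3 * real_of_int H) ^ d * card D)" for n0 :: nat
  proof -
    define T where "T = n0 + 1"
    have T: "T \<ge> 1" by (simp add: T_def)
    define U where "U = PiE {..<d} (\<lambda>_. {..<T})"
    define L where "L u = (\<Sum>i<d. real (u i) * e i)" for u :: "nat \<Rightarrow> nat"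
    \<comment> \<open>The values of \<open>L\<close> lie in \<open>{- M * T..M * T}\<close>, which
      this map sends to the unit interval.\<close>
    define D where "D = (\<lambda>u. (L u + M * T) / (2 * M * T)) ` U"
    have L_diff: "L u - L v = (\<Sum>i<d. of_int (int (u i) - int (v i)) * e i)" for u v
      by (simp add: L_def left_diff_distrib sum_subtractf)
    have u_less: "u i < T" if "u \<in> U" "i < d" for u i
      using that by (auto simp: U_def)
    have inj: "inj_on L U"
    proof (rule inj_onI)
      fix u v assume uv: "u \<in> U" "v \<in> U" "L u = L v"
      then have "\<forall>i<d. int (u i) - int (v i) = 0" using L_diff[of u v] by (intro ind) simp
      then show "u = v" using uv(1,2) by (auto simp: U_def intro: PiE_ext)
    qed
    have finU: "finite U" by (auto simp: U_def intro: finite_PiE)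
    have cardD: "card D = T ^ d"
    proof -
      have "inj_on (\<lambda>u. (L u + M * T) / (2 * M * T)) U"
        using inj M T by (auto simp: inj_on_def)
      then have "card D = card U" unfolding D_def by (rule card_image)
      then show ?thesis by (simp add: U_def card_PiE)
    qed
    have L_abs: "\<bar>L u\<bar> \<le> M * T" if "u \<in> U" for u
    proof -
      have "\<bar>L u\<bar> \<le> (\<Sum>i<d. real (u i) * \<bar>e i\<bar>)"
        unfolding L_def by (rule order_trans[OF sum_abs]) (simp add: abs_mult)
      also have "\<dots> \<le> (\<Sum>i<d. T * \<bar>e i\<bar>)"
        by (intro sum_mono mult_right_mono) (use u_less[OF that] in \<open>auto intro: less_imp_le\<close>)
      finally show ?thesis by (simp add: M_def mult.commute flip: sum_distrib_left)
    qed
    have D01: "D \<subseteq> {0..1}"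
    proof
      fix x assume "x \<in> D"
      then obtain u where u: "u \<in> U" "x = (L u + M * T) / (2 * M * T)" by (auto simp: D_def)
      have "0 \<le> L u + M * T" "L u + M * T \<le> 2 * M * T" using L_abs[OF u(1)] by linarith+
      then show "x \<in> {0..1}" using M T by (simp add: u(2) divide_le_eq)
    qed
    have sep: "c0 / card D \<le> \<bar>x - y\<bar>" if xy: "x \<in> D" "y \<in> D" "x \<noteq> y" for x y
    proof -
      obtain u v where uv: "u \<in> U" "v \<in> U" "x = (L u + M * T) / (2 * M * T)" "y = (L v + M * T) / (2 * M * T)"
        using xy(1,2) by (auto simp: D_def)
      have "u \<noteq> v" using uv xy(3) by auto
      then have ne: "\<exists>i<d. int (u i) - int (v i) \<noteq> 0" using uv(1,2) by (auto simp: U_def intro: PiE_ext)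
      have le: "\<bar>of_int (int (u i) - int (v i))\<bar> \<le> real T" if "i < d" for i
        using u_less[OF uv(1) that] u_less[OF uv(2) that] by linarith
      have "\<kappa> / real T ^ (d - 1) \<le> \<bar>L u - L v\<bar>"
        unfolding L_diff by (rule \<kappa>(2)[rule_format, OF _ le ne]) (use T in auto)
      from divide_right_mono[OF this, of "2 * M * T"]
      have "\<kappa> / real T ^ (d - 1) / (2 * M * T) \<le> \<bar>L u - L v\<bar> / (2 * M * T)" using M by simp
      also have "\<dots> = \<bar>x - y\<bar>"
        using M by (simp add: uv abs_divide abs_mult flip: diff_divide_distrib)
      finally have "\<kappa> / real T ^ (d - 1) / (2 * M * T) \<le> \<bar>x - y\<bar>" .
      moreover have "real T ^ d = real T ^ (d - 1) * T" using d by (simp flip: power_Suc2)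
      ultimately have "\<kappa> / (2 * M) / T ^ d \<le> \<bar>x - y\<bar>" by (simp add: mult_ac)
      moreover have "c0 / T ^ d \<le> \<kappa> / (2 * M) / T ^ d"
        by (intro divide_right_mono) (auto simp: c0_def)
      ultimately show ?thesis using cardD by simp
    qed
    have few: "real (card (dilated_differences s D)) \<le> (3 * real_of_int H) ^ d * real (card D)" if s: "s \<in> S" for s
    proof -
      \<comment> \<open>The box of possible coefficient vectors; the shifts by \<open>M * T\<close>
        cancel in the differences.\<close>
      define W where "W = PiE {..<d} (\<lambda>_. {- H * int T..H * int T})"
      define g where "g w = (\<Sum>l<d. of_int (w l) * e l) / (2 * M * T * of_int q)" for w :: "nat \<Rightarrow> int"
      have "dilated_differences s D \<subseteq> g ` W"
      proof
        fix z assume "z \<in> dilated_differences s D"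
        then obtain u v u' v' where U: "u \<in> U" "v \<in> U" "u' \<in> U" "v' \<in> U"
          and z: "z = ((L u + M * T) / (2 * M * T) - (L v + M * T) / (2 * M * T))
                + s * ((L u' + M * T) / (2 * M * T) - (L v' + M * T) / (2 * M * T))"
          by (auto simp: dilated_differences_def D_def)
        define \<delta> where "\<delta> i = int (u i) - int (v i)" for i
        define \<delta>' where "\<delta>' i = int (u' i) - int (v' i)" for i
        define w where "w = (\<lambda>l\<in>{..<d}. q * \<delta> l + (\<Sum>j<d. \<delta>' j * a s j l))"
        have "\<bar>\<delta> i\<bar> \<le> T" "\<bar>\<delta>' i\<bar> \<le> T" if "i < d" for i
          using u_less[OF U(1) that] u_less[OF U(2) that] u_less[OF U(3) that] u_less[OF U(4) that]
          unfolding \<delta>_def \<delta>'_def by linarith+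
        note \<delta> = this
        have "w \<in> W"
          unfolding W_def
        proof (rule PiE_I)
          fix l assume "l \<in> {..<d}"
          then have l: "l < d" by simp
          have "\<bar>w l\<bar> \<le> q * \<bar>\<delta> l\<bar> + (\<Sum>j<d. \<bar>\<delta>' j\<bar> * \<bar>a s j l\<bar>)"
            using l q sum_abs[of "\<lambda>j. \<delta>' j * a s j l" "{..<d}"] abs_triangle_ineq[of "q * \<delta> l" "\<Sum>j<d. \<delta>' j * a s j l"]
            by (simp add: w_def abs_mult)
          also have "\<dots> \<le> q * T + (\<Sum>j<d. T * \<bar>a s j l\<bar>)"
            using \<delta> l q by (intro add_mono mult_left_mono sum_mono mult_right_mono) auto
          also have "\<dots> = (q + (\<Sum>j<d. \<bar>a s j l\<bar>)) * T"
            by (simp add: distrib_left sum_distrib_left mult.commute)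
          also have "\<dots> \<le> H * T" using H[OF s l] by (intro mult_right_mono) auto
          finally show "w l \<in> {- H * int T..H * int T}" by auto
        qed (simp add: w_def)
        have "of_int q * ((L u - L v) + s * (L u' - L v')) =
            (\<Sum>l<d. of_int (q * \<delta> l) * e l) + (\<Sum>j<d. of_int (\<delta>' j) * (of_int q * (s * e j)))"
          by (simp add: L_diff \<delta>_def \<delta>'_def distrib_left sum_distrib_left mult_ac)
        also have "(\<Sum>j<d. of_int (\<delta>' j) * (of_int q * (s * e j))) =
            (\<Sum>j<d. \<Sum>l<d. of_int (\<delta>' j * a s j l) * e l)"
          using a s by (intro sum.cong refl, subst a[rule_format]) (auto simp: sum_distrib_left mult_ac)
        also have "\<dots> = (\<Sum>l<d. \<Sum>j<d. of_int (\<delta>' j * a s j l) * e l)"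
          by (rule sum.swap)
        also have "(\<Sum>l<d. of_int (q * \<delta> l) * e l) + \<dots> = (\<Sum>l<d. of_int (w l) * e l)"
          by (simp add: w_def distrib_right sum.distrib sum_distrib_right)
        finally have eq: "of_int q * ((L u - L v) + s * (L u' - L v')) = (\<Sum>l<d. of_int (w l) * e l)" .
        have "z = ((L u - L v) + s * (L u' - L v')) / (2 * M * T)"
          by (simp add: z add_divide_distrib diff_divide_distrib[symmetric])
        also have "\<dots> = g w" using q by (simp add: g_def eq[symmetric])
        finally show "z \<in> g ` W" using \<open>w \<in> W\<close> by blast
      qed
      moreover have "finite W" by (auto simp: W_def intro: finite_PiE)
      ultimately have "card (dilated_differences s D) \<le> card W"
        by (meson card_image_le card_mono finite_imageI order_trans)
      also have "card W = nat (2 * H * int T + 1) ^ d"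
        by (simp add: W_def card_PiE mult.assoc)
      finally have "real (card (dilated_differences s D)) \<le> real (nat (2 * H * int T + 1)) ^ d"
        by (metis of_nat_le_iff of_nat_power)
      also have "\<dots> \<le> (3 * of_int H * real T) ^ d"
      proof (rule power_mono)
        have "1 * 1 \<le> H * int T" using H1 T by (intro mult_mono) auto
        then have "2 * H * int T + 1 \<le> 3 * H * int T" by simp
        then have "real_of_int (2 * H * int T + 1) \<le> real_of_int (3 * H * int T)"
          by (subst of_int_le_iff)
        then show "real (nat (2 * H * int T + 1)) \<le> 3 * of_int H * real T"
          using H1 by simp
      qed simp
      also have "\<dots> = (3 * real_of_int H) ^ d * real (card D)" by (simp add: cardD power_mult_distrib)
      finally show ?thesis .
    qed
    have "n0 \<le> T ^ d" using self_le_power[of T d] T d by (simp add: T_def)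
    then show ?thesis
      using D01 sep few finU cardD by (intro exI[of _ D]) (auto simp: D_def)
  qed
  ultimately show thesis by (intro that[of c0 "(3 * real_of_int H) ^ d"]) auto
qed

section \<open>Cantor sets with well spaced digits\<close>

text \<open>Digit \<open>i < n j\<close> in position \<open>j\<close> contributes \<open>r j * p j i\<close>. The function \<open>expansion\<close> replaces
  each digit of \<open>t\<close> in mixed radix \<open>n 0, n 1, ...\<close> by its contribution, and \<open>expansion_hoelder\<close> is
  Hoelder continuity of its inverse.\<close>

locale digit_expansion =
  fixes n :: "nat \<Rightarrow> nat" and p :: "nat \<Rightarrow> nat \<Rightarrow> real" and r :: "nat \<Rightarrow> real" and c :: real
  assumes n_ge_2: "2 \<le> n j"
    and r_pos: "0 < r j"
    and c_pos: "0 < c" and c_le_1: "c \<le> 1"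
    and p_unit: "i < n j \<Longrightarrow> p j i \<in> {0..1}"
    and p_sep: "i < n j \<Longrightarrow> i' < n j \<Longrightarrow> c / n j * \<bar>real i - real i'\<bar> \<le> \<bar>p j i - p j i'\<bar>"
    and r_Suc: "r (Suc j) \<le> c * r j / (4 * n j)"
begin

definition base :: "nat \<Rightarrow> nat" where
  "base j = (\<Prod>i<j. n i)"

text \<open>For \<open>t\<close> in \<open>{0..<1}\<close> these are the first \<open>j\<close>
  mixed radix digits read as one integer. Digits are numbered from 0, so digit \<open>j\<close>
  enters with \<open>truncation (Suc j)\<close>.\<close>

definition truncation :: "nat \<Rightarrow> real \<Rightarrow> nat" where
  "truncation j t = nat \<lfloor>t * base j\<rfloor>"

definition digit :: "nat \<Rightarrow> real \<Rightarrow> nat" where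
  "digit j t = truncation (Suc j) t mod n j"

definition summand :: "real \<Rightarrow> nat \<Rightarrow> real" where
  "summand t j = r j * p j (digit j t)"

definition expansion :: "real \<Rightarrow> real" where
  "expansion t = (\<Sum>j. summand t j)"

section \<open>Mixed radix digits and tail estimates\<close>

lemma n_pos: "0 < n j"
  using n_ge_2[of j] by linarith

lemma digit_less: "digit j t < n j"
  by (simp add: digit_def n_pos)

lemma base_0: "base 0 = 1" and base_Suc: "base (Suc j) = base j * n j"
  by (simp_all add: base_def)

lemma base_ge: "2 ^ j \<le> base j"
proof (induction j)
  case (Suc j)
  then show ?case using mult_mono[OF Suc n_ge_2[of j]] by (simp add: base_Suc mult.commute)
qed (simp add: base_0)

lemma base_pos: "0 < base j"
  using base_ge[of j] by (meson less_le_trans zero_less_numeral zero_less_power)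

lemma truncation_Suc:
  assumes "0 \<le> t"
  shows "truncation (Suc j) t = truncation j t * n j + digit j t"
proof -
  have eq: "t * base j = t * base (Suc j) / real_of_int (int (n j))"
    using n_pos[of j] by (simp add: base_Suc)
  have "\<lfloor>t * base j\<rfloor> = \<lfloor>t * base (Suc j)\<rfloor> div int (n j)"
    unfolding eq by (rule floor_divide_real_eq_div) simp
  then have "truncation j t = truncation (Suc j) t div n j"
    using assms by (simp add: truncation_def nat_div_distrib)
  then show ?thesis by (simp only: digit_def div_mult_mod_eq)
qed

lemma r_Suc_le: "r (Suc j) \<le> r j / 4"
proof -
  have "c / n j \<le> 1"
    using c_le_1 n_ge_2[of j] by (simp add: divide_le_eq)
  then have "r j * (c / n j) \<le> r j * 1"
    using r_pos[of j] by (intro mult_left_mono) auto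
  then have "r j * (c / n j) / 4 \<le> r j / 4" by simp
  moreover have "r (Suc j) \<le> r j * (c / n j) / 4" using r_Suc[of j] by (simp add: mult.commute)
  ultimately show ?thesis by (rule order_trans[rotated])
qed

lemma r_add_le: "r (i + j) \<le> r j * (1/4) ^ i"
proof (induction i)
  case (Suc i)
  then show ?case using r_Suc_le[of "i + j"] by simp
qed simp

lemma summable_r: "summable (\<lambda>i. r (i + j))"
  by (rule summable_comparison_test'[of "\<lambda>i. r j * (1/4) ^ i" 0])
     (use r_add_le r_pos in \<open>auto intro!: summable_mult summable_geometric simp: less_imp_le\<close>)

text \<open>The geometric series of ratio 1/4 gives 4/3, rounded up to 2.\<close>

lemma suminf_r_le: "(\<Sum>i. r (i + j)) \<le> 2 * r j"
proof -
  have "(\<Sum>i. r (i + j)) \<le> (\<Sum>i. r j * (1/4) ^ i)"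
    by (intro suminf_le r_add_le summable_r summable_mult summable_geometric) auto
  also have "\<dots> = r j * (4/3)"
    by (subst suminf_mult) (auto simp: suminf_geometric intro!: summable_geometric)
  also have "\<dots> \<le> 2 * r j" using r_pos[of j] by simp
  finally show ?thesis .
qed

lemma summand_bounds: "0 \<le> summand t j" "summand t j \<le> r j"
  using p_unit[OF digit_less[of j t]] r_pos[of j] mult_left_mono[of "p j (digit j t)" 1 "r j"]
  by (auto simp: summand_def)

lemma summable_summand: "summable (\<lambda>i. summand t (i + j))"
  by (rule summable_comparison_test'[OF summable_r[of j], of 0]) (use summand_bounds in auto)

lemma summand_tail_bounds:
  "0 \<le> (\<Sum>i. summand t (i + j))" "(\<Sum>i. summand t (i + j)) \<le> 2 * r j"
proof -
  show "0 \<le> (\<Sum>i. summand t (i + j))"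
    by (intro suminf_nonneg summable_summand summand_bounds)
  have "(\<Sum>i. summand t (i + j)) \<le> (\<Sum>i. r (i + j))"
    by (intro suminf_le summable_summand summable_r summand_bounds)
  with suminf_r_le[of j] show "(\<Sum>i. summand t (i + j)) \<le> 2 * r j" by linarith
qed

lemma expansion_split: "expansion t = (\<Sum>i<j. summand t i) + (\<Sum>i. summand t (i + j))"
  using suminf_split_initial_segment[of "summand t" j] summable_summand[of t 0]
  by (simp add: expansion_def)

text \<open>At the first truncation where \<open>t\<close> and \<open>t'\<close> disagree, the two
  integers differ exactly by the digit difference. The two rounding errors differ by less than 1, so
  the scaled distance is below the digit difference plus 1, hence below twice that
  difference.\<close>

lemma first_different_digit:
  assumes "t \<in> {0..<1}" "t' \<in> {0..<1}" "t \<noteq> t'"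
  obtains k where "\<And>i. i < k \<Longrightarrow> digit i t = digit i t'" "digit k t \<noteq> digit k t'"
    "\<bar>t - t'\<bar> * base (Suc k) \<le> 2 * \<bar>real (digit k t) - real (digit k t')\<bar>"
proof -
  obtain J :: nat where J: "1 / \<bar>t - t'\<bar> < 2 ^ J"
    using real_arch_pow[of 2 "1 / \<bar>t - t'\<bar>"] by auto
  have trunc: "\<bar>t * base j - t' * base j\<bar> < \<bar>real (truncation j t) - real (truncation j t')\<bar> + 1" for j
  proof -
    have "real (truncation j t) = of_int \<lfloor>t * base j\<rfloor>" "real (truncation j t') = of_int \<lfloor>t' * base j\<rfloor>"
      using assms(1,2) by (auto simp: truncation_def)
    then show ?thesis by linarith
  qed
  have "real (2 ^ J) \<le> real (base J)" using base_ge by (rule of_nat_mono)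
  then have "2 ^ J \<le> real (base J)" by (simp only: of_nat_power of_nat_numeral)
  with J have "1 / \<bar>t - t'\<bar> < base J" by linarith
  then have "1 < \<bar>t - t'\<bar> * base J" using assms(3) by (simp add: divide_less_eq mult.commute)
  also have "\<dots> = \<bar>t * base J - t' * base J\<bar>" by (simp add: abs_mult flip: left_diff_distrib)
  finally have "truncation J t \<noteq> truncation J t'" using trunc[of J] by auto
  then obtain k' where k': "truncation k' t \<noteq> truncation k' t'"
      "\<And>i. i < k' \<Longrightarrow> truncation i t = truncation i t'"
    using exists_least_iff[of "\<lambda>j. truncation j t \<noteq> truncation j t'"] by auto
  \<comment> \<open>On \<open>{0..<1}\<close> the truncations at 0 vanish, so the first disagreement
    \<open>k'\<close> has a predecessor \<open>k\<close>.\<close>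
  have "\<lfloor>t\<rfloor> = 0" "\<lfloor>t'\<rfloor> = 0" using assms by (auto simp: floor_eq_iff)
  with k'(1) have "k' \<noteq> 0" by (auto simp: truncation_def base_0 intro!: gr0I)
  show ?thesis
  proof (cases k')
    case 0
    with \<open>k' \<noteq> 0\<close> show ?thesis by simp
  next
    case (Suc k)
    have eq: "real (truncation k' t) - real (truncation k' t') = real (digit k t) - real (digit k t')"
      using truncation_Suc[of t k] truncation_Suc[of t' k] assms(1,2) k'(2)[of k] Suc by simp
    have ne: "digit k t \<noteq> digit k t'" using eq k'(1) by auto
    show ?thesis
    proof (rule that[OF _ ne])
      show "digit i t = digit i t'" if "i < k" for i
        using k'(2)[of "Suc i"] that Suc by (simp add: digit_def)
      have "\<bar>t - t'\<bar> * base (Suc k) = \<bar>t * base k' - t' * base k'\<bar>"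
        by (simp add: Suc abs_mult flip: left_diff_distrib)
      also have "\<dots> < \<bar>real (digit k t) - real (digit k t')\<bar> + 1" using trunc[of k'] eq by simp
      finally show "\<bar>t - t'\<bar> * base (Suc k) \<le> 2 * \<bar>real (digit k t) - real (digit k t')\<bar>"
        using ne by (cases "digit k t < digit k t'") auto
    qed
  qed
qed

lemma expansion_hoelder:
  assumes \<gamma>: "0 < \<gamma>" "\<gamma> \<le> 1" and G: "\<And>j. 1 / base j \<le> G * r j powr \<gamma>"
    and t: "t \<in> {0..<1}" "t' \<in> {0..<1}"
  shows "\<bar>t - t'\<bar> \<le> 2 * G * (2 / c) powr \<gamma> * \<bar>expansion t - expansion t'\<bar> powr \<gamma>"
proof (cases "t = t'")
  case False
  obtain k where k: "\<And>i. i < k \<Longrightarrow> digit i t = digit i t'" "digit k t \<noteq> digit k t'"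
    "\<bar>t - t'\<bar> * base (Suc k) \<le> 2 * \<bar>real (digit k t) - real (digit k t')\<bar>"
    using first_different_digit[OF t False] by blast
  define m where "m = \<bar>real (digit k t) - real (digit k t')\<bar>"
  have m: "1 \<le> m" "m \<le> n k" using k(2) digit_less[of k t] digit_less[of k t'] by (auto simp: m_def)
  \<comment> \<open>The instance \<open>j = 0\<close> of the assumption forces \<open>G\<close> to
    be nonnegative.\<close>
  have "0 \<le> 1 / real (base 0)" by simp
  also have "\<dots> \<le> G * r 0 powr \<gamma>" by (rule G)
  finally have G0: "0 \<le> G" using r_pos[of 0] by (simp add: zero_le_mult_iff)
  \<comment> \<open>Applied with \<open>a\<close> the difference at position \<open>k\<close>,
    \<open>b\<close> the difference of the tails and \<open>y\<close> a lower bound for the size of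
    \<open>a\<close>: the tails cancel at most half of it.\<close>
  have aux: "y / 2 \<le> \<bar>z\<bar>" if "z = a + b" "\<bar>b\<bar> \<le> x" "x \<le> y / 2" "y \<le> \<bar>a\<bar>" for a b x y z :: real
    using that by linarith
  have "(\<Sum>i<k. summand t i) = (\<Sum>i<k. summand t' i)"
    by (rule sum.cong) (auto simp: summand_def k(1))
  then have "expansion t - expansion t' = (summand t k - summand t' k) +
      ((\<Sum>i. summand t (i + Suc k)) - (\<Sum>i. summand t' (i + Suc k)))"
    unfolding expansion_split[of _ "Suc k"] by simp
  moreover have "\<bar>(\<Sum>i. summand t (i + Suc k)) - (\<Sum>i. summand t' (i + Suc k))\<bar> \<le> 2 * r (Suc k)"
    using summand_tail_bounds[of t "Suc k"] summand_tail_bounds[of t' "Suc k"] by linarith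
  \<comment> \<open>The factor 4 in \<open>r_Suc\<close> makes the tail at most half of the smallest
    gap at position \<open>k\<close>; \<open>m \<ge> 1\<close> does the rest.\<close>
  moreover have "2 * r (Suc k) \<le> r k * (c / n k * m) / 2"
  proof -
    have "2 * r (Suc k) \<le> r k * (c / n k) / 2" using r_Suc[of k] by (simp add: field_simps)
    also have "\<dots> = r k * (c / n k) / 2 * 1" by simp
    also have "\<dots> \<le> r k * (c / n k) / 2 * m"
      using m r_pos[of k] c_pos by (intro mult_left_mono) auto
    finally show ?thesis by (simp add: mult_ac)
  qed
  moreover have "r k * (c / n k * m) \<le> \<bar>summand t k - summand t' k\<bar>"
  proof -
    have "c / n k * m \<le> \<bar>p k (digit k t) - p k (digit k t')\<bar>"
      unfolding m_def by (intro p_sep digit_less)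
    then have "r k * (c / n k * m) \<le> r k * \<bar>p k (digit k t) - p k (digit k t')\<bar>"
      using r_pos[of k] by (intro mult_left_mono) auto
    also have "\<dots> = \<bar>summand t k - summand t' k\<bar>"
      using r_pos[of k] by (simp add: summand_def abs_mult flip: right_diff_distrib)
    finally show ?thesis .
  qed
  ultimately have "r k * (c / n k * m) / 2 \<le> \<bar>expansion t - expansion t'\<bar>" by (rule aux)
  from mult_left_mono[OF this, of "2 / c"]
  have le: "r k * (m / n k) \<le> 2 / c * \<bar>expansion t - expansion t'\<bar>"
    using c_pos by simp
  have mn: "0 < m / n k" "m / n k \<le> 1" using m n_pos[of k] by auto
  have "\<bar>t - t'\<bar> \<le> 2 * (m / n k) * (1 / base k)"
    using k(3) base_pos[of k] n_pos[of k] by (simp add: m_def base_Suc field_simps)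
  \<comment> \<open>A number in the unit interval does not decrease when raised to a power
    \<open>\<gamma> \<le> 1\<close>; \<open>G\<close> compares \<open>1 / base k\<close> with
    \<open>r k\<close>.\<close>
  also have "\<dots> \<le> 2 * (m / n k) powr \<gamma> * (G * r k powr \<gamma>)"
  proof (intro mult_mono mult_nonneg_nonneg G order_refl)
    show "m / n k \<le> (m / n k) powr \<gamma>" using powr_mono'[of \<gamma> 1 "m / n k"] \<gamma> mn m(1) by simp
  qed (use mn in auto)
  also have "\<dots> = 2 * G * (r k * (m / n k)) powr \<gamma>"
    using r_pos[of k] mn by (subst powr_mult) auto
  also have "\<dots> \<le> 2 * G * (2 / c * \<bar>expansion t - expansion t'\<bar>) powr \<gamma>"
  proof (intro mult_left_mono powr_mono2 le)
    show "0 \<le> r k * (m / n k)" using r_pos[of k] mn by (intro mult_nonneg_nonneg) auto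
  qed (use G0 \<gamma> in auto)
  also have "\<dots> = 2 * G * (2 / c) powr \<gamma> * \<bar>expansion t - expansion t'\<bar> powr \<gamma>"
    using c_pos by (subst powr_mult) auto
  finally show ?thesis .
qed simp

section \<open>The Cantor set and its dilated differences\<close>

definition partial_sums :: "nat \<Rightarrow> real set" where
  "partial_sums j = (\<lambda>u. \<Sum>i<j. r i * p i (u i)) ` (PiE {..<j} (\<lambda>i. {..<n i}))"

lemma finite_partial_sums: "finite (partial_sums j)"
  by (auto simp: partial_sums_def intro!: finite_PiE)

lemma card_partial_sums: "card (partial_sums j) \<le> base j"
proof -
  have "card (partial_sums j) \<le> card (PiE {..<j} (\<lambda>i. {..<n i}))"
    unfolding partial_sums_def by (rule card_image_le) (auto intro: finite_PiE)
  then show ?thesis by (simp add: card_PiE base_def)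
qed

lemma sum_summand_in_partial_sums: "(\<Sum>i<j. summand t i) \<in> partial_sums j"
  unfolding partial_sums_def summand_def
  by (rule image_eqI[of _ _ "\<lambda>i\<in>{..<j}. digit i t"]) (auto intro!: sum.cong digit_less)

definition attractor :: "real set" where
  "attractor = closure (range expansion)"

text \<open>An expansion is a partial sum, then the contribution of digit \<open>j\<close>, then a
  tail in \<open>{0..2 * r (Suc j)}\<close>. The resulting finite union of closed intervals is
  closed and therefore contains the closure too.\<close>

lemma attractor_subset:
  "attractor \<subseteq> (\<Union>x\<in>partial_sums j. \<Union>y\<in>p j ` {..<n j}. {x + r j * y..x + r j * y + 2 * r (Suc j)})"
  (is "_ \<subseteq> ?K")
  unfolding attractor_def
proof (rule closure_minimal)
  show "closed ?K" using finite_partial_sums by (intro closed_UN) auto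
  show "range expansion \<subseteq> ?K"
  proof (clarify)
    fix t
    have "expansion t = (\<Sum>i<j. summand t i) + r j * p j (digit j t) + (\<Sum>i. summand t (i + Suc j))"
      by (subst expansion_split[of t "Suc j"]) (simp add: summand_def)
    then have "expansion t \<in> {(\<Sum>i<j. summand t i) + r j * p j (digit j t)..
        (\<Sum>i<j. summand t i) + r j * p j (digit j t) + 2 * r (Suc j)}"
      using summand_tail_bounds[of t "Suc j"] by auto
    then show "expansion t \<in> ?K"
      using sum_summand_in_partial_sums[of t j] digit_less[of j t] by blast
  qed
qed

lemma compact_attractor: "compact attractor"
proof -
  have "range expansion \<subseteq> {0..2 * r 0}"
    using expansion_split[of _ 0] summand_tail_bounds[of _ 0] by auto
  then have "bounded (range expansion)" using bounded_closed_interval bounded_subset by blast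
  then show ?thesis by (simp add: attractor_def compact_closure)
qed

lemma attractor_decompose:
  assumes "a \<in> attractor"
  obtains x y b where "a = x + r j * y + b" "x \<in> partial_sums j" "y \<in> p j ` {..<n j}" "0 \<le> b" "b \<le> 2 * r (Suc j)"
proof -
  from subsetD[OF attractor_subset assms] obtain x y where "x \<in> partial_sums j" "y \<in> p j ` {..<n j}"
      "a \<in> {x + r j * y..x + r j * y + 2 * r (Suc j)}"
    by blast
  then show thesis by (intro that[of x y "a - (x + r j * y)"]) auto
qed

text \<open>A dilated difference is linear in its four points, so it splits into the parts from the
  partial sums, from the digits at position \<open>j\<close> and from the tails; the tails only
  thicken the result.\<close>

lemma dilated_differences_attractor_subset:
  "dilated_differences s attractor \<subseteq>
     (\<Union>(w, v)\<in>dilated_differences s (partial_sums j) \<times> dilated_differences s (p j ` {..<n j}).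
        cball (w + r j * v) (2 * (1 + \<bar>s\<bar>) * r (Suc j)))"
proof
  fix z assume "z \<in> dilated_differences s attractor"
  then obtain a0 a1 a2 a3 where a: "a0 \<in> attractor" "a1 \<in> attractor" "a2 \<in> attractor" "a3 \<in> attractor"
    and z: "z = (a0 - a1) + s * (a2 - a3)"
    by (auto simp: dilated_differences_def)
  obtain x0 y0 b0 where 0: "a0 = x0 + r j * y0 + b0" "x0 \<in> partial_sums j" "y0 \<in> p j ` {..<n j}" "0 \<le> b0" "b0 \<le> 2 * r (Suc j)"
    using a(1) by (rule attractor_decompose)
  obtain x1 y1 b1 where 1: "a1 = x1 + r j * y1 + b1" "x1 \<in> partial_sums j" "y1 \<in> p j ` {..<n j}" "0 \<le> b1" "b1 \<le> 2 * r (Suc j)"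
    using a(2) by (rule attractor_decompose)
  obtain x2 y2 b2 where 2: "a2 = x2 + r j * y2 + b2" "x2 \<in> partial_sums j" "y2 \<in> p j ` {..<n j}" "0 \<le> b2" "b2 \<le> 2 * r (Suc j)"
    using a(3) by (rule attractor_decompose)
  obtain x3 y3 b3 where 3: "a3 = x3 + r j * y3 + b3" "x3 \<in> partial_sums j" "y3 \<in> p j ` {..<n j}" "0 \<le> b3" "b3 \<le> 2 * r (Suc j)"
    using a(4) by (rule attractor_decompose)
  define w where "w = (x0 - x1) + s * (x2 - x3)"
  define v where "v = (y0 - y1) + s * (y2 - y3)"
  have "\<bar>z - (w + r j * v)\<bar> = \<bar>(b0 - b1) + s * (b2 - b3)\<bar>"
    unfolding z w_def v_def 0(1) 1(1) 2(1) 3(1) by (simp add: algebra_simps)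
  also have "\<dots> \<le> \<bar>b0 - b1\<bar> + \<bar>s\<bar> * \<bar>b2 - b3\<bar>" by (metis abs_triangle_ineq abs_mult)
  also have "\<dots> \<le> 2 * r (Suc j) + \<bar>s\<bar> * (2 * r (Suc j))"
    using 0(4,5) 1(4,5) 2(4,5) 3(4,5) by (intro add_mono mult_left_mono) auto
  also have "\<dots> = 2 * (1 + \<bar>s\<bar>) * r (Suc j)" by (simp add: algebra_simps)
  finally have "z \<in> cball (w + r j * v) (2 * (1 + \<bar>s\<bar>) * r (Suc j))"
    by (simp add: dist_real_def abs_minus_commute)
  moreover have "w \<in> dilated_differences s (partial_sums j)"
    unfolding w_def by (intro dilated_differencesI 0 1 2 3)
  moreover have "v \<in> dilated_differences s (p j ` {..<n j})"
    unfolding v_def by (intro dilated_differencesI 0 1 2 3)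
  ultimately show "z \<in> (\<Union>(w, v)\<in>dilated_differences s (partial_sums j) \<times> dilated_differences s (p j ` {..<n j}).
        cball (w + r j * v) (2 * (1 + \<bar>s\<bar>) * r (Suc j)))" by blast
qed

text \<open>The cover at level \<open>j\<close> has at most \<open>base j ^ 4 * (C * n j)\<close>
  intervals of length \<open>4 * (1 + \<bar>s\<bar>) * r (Suc j)\<close>. Only the earlier digits
  are counted wastefully, by a fourth power; the new digit set costs a factor linear in
  \<open>n j\<close>.\<close>

lemma negligible_dilated_differences_attractor:
  fixes C :: real
  assumes C: "\<And>j. card (dilated_differences s (p j ` {..<n j})) \<le> C * n j"
    and lim: "(\<lambda>j. base j ^ 4 * n j * r (Suc j)) \<longlonglongrightarrow> 0"
  shows "negligible (dilated_differences s attractor)"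
  unfolding negligible_outer_le
proof (intro allI impI)
  fix \<epsilon> :: real assume "\<epsilon> > 0"
  have "(\<lambda>j. (4 * (1 + \<bar>s\<bar>) * C) * (base j ^ 4 * n j * r (Suc j))) \<longlonglongrightarrow> 0"
    using tendsto_mult_left[OF lim, of "4 * (1 + \<bar>s\<bar>) * C"] by simp
  then have "eventually (\<lambda>j. (4 * (1 + \<bar>s\<bar>) * C) * (base j ^ 4 * n j * r (Suc j)) < \<epsilon>) sequentially"
    using \<open>\<epsilon> > 0\<close> by (rule order_tendstoD)
  then obtain j where j: "(4 * (1 + \<bar>s\<bar>) * C) * (base j ^ 4 * n j * r (Suc j)) < \<epsilon>"
    by (auto simp: eventually_sequentially)
  define \<rho> where "\<rho> = 2 * (1 + \<bar>s\<bar>) * r (Suc j)"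
  have "\<rho> \<ge> 0" using r_pos[of "Suc j"] by (simp add: \<rho>_def)
  define P where "P = dilated_differences s (partial_sums j)"
  define Q where "Q = dilated_differences s (p j ` {..<n j})"
  define T where "T = (\<Union>(w, v)\<in>P \<times> Q. cball (w + r j * v) \<rho>)"
  have fin: "finite P" "finite Q"
    using finite_partial_sums by (auto simp: P_def Q_def dilated_differences_def)
  have "card P \<le> base j ^ 4"
  proof -
    have "card P \<le> card (partial_sums j) ^ 4"
      unfolding P_def dilated_differences_def
      using card_image_le[of "partial_sums j \<times> partial_sums j \<times> partial_sums j \<times> partial_sums j"]
        finite_partial_sums by (auto simp: card_cartesian_product power4_eq_xxxx mult.assoc)
    also have "\<dots> \<le> base j ^ 4" by (intro power_mono card_partial_sums) auto
    finally show ?thesis .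
  qed
  have "dilated_differences s attractor \<subseteq> T"
    using dilated_differences_attractor_subset[of s j] by (simp add: T_def P_def Q_def \<rho>_def)
  moreover have "T \<in> lmeasurable"
    unfolding T_def using fin by (intro fmeasurable.finite_UN) auto
  moreover have "measure lebesgue T \<le> \<epsilon>"
  proof -
    have "measure lebesgue T \<le> (\<Sum>(w, v)\<in>P \<times> Q. measure lebesgue (cball (w + r j * v) \<rho>))"
      unfolding T_def case_prod_unfold using fin by (intro measure_UNION_le) auto
    also have "\<dots> = (\<Sum>(w, v)\<in>P \<times> Q. 2 * \<rho>)"
      using \<open>\<rho> \<ge> 0\<close> by (intro sum.cong) (auto simp: cball_eq_atLeastAtMost)
    also have "\<dots> = card P * (card Q * (2 * \<rho>))" by (simp add: case_prod_unfold card_cartesian_product)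
    also have "\<dots> \<le> base j ^ 4 * (C * n j * (2 * \<rho>))"
      using C[of j] \<open>card P \<le> base j ^ 4\<close> \<open>\<rho> \<ge> 0\<close>
      by (intro mult_mono) (auto simp: Q_def intro: order_trans[OF of_nat_0_le_iff])
    also have "\<dots> \<le> \<epsilon>" using j by (simp add: \<rho>_def algebra_simps)
    finally show ?thesis .
  qed
  ultimately show "\<exists>T. dilated_differences s attractor \<subseteq> T \<and> T \<in> lmeasurable \<and> measure lebesgue T \<le> \<epsilon>"
    by blast
qed

end

text \<open>In increasing order consecutive points are at least \<open>\<delta>\<close> apart, and
  the gaps add up. A bound proportional to the difference of indices is what
  \<open>digit_expansion\<close> demands of its digits.\<close>

lemma sorted_enumeration_separated:
  fixes D :: "real set"
  assumes "finite D" and sep: "\<And>x y. x \<in> D \<Longrightarrow> y \<in> D \<Longrightarrow> x \<noteq> y \<Longrightarrow> \<delta> \<le> \<bar>x - y\<bar>"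
  obtains p where "p ` {..<card D} = D"
    "\<And>i i'. i < card D \<Longrightarrow> i' < card D \<Longrightarrow> \<delta> * \<bar>real i - real i'\<bar> \<le> \<bar>p i - p i'\<bar>"
proof -
  define xs where "xs = sorted_list_of_set D"
  have xs: "set xs = D" "length xs = card D" "sorted_wrt (<) xs"
    using assms(1) by (auto simp: xs_def)
  have mono: "\<delta> * (real i' - real i) \<le> xs ! i' - xs ! i" if "i \<le> i'" "i' < card D" for i i'
    using that
  proof (induction i' rule: dec_induct)
    case (step m)
    have "xs ! m < xs ! Suc m" using xs step by (intro sorted_wrt_nth_less[OF xs(3)]) auto
    moreover have "xs ! m \<in> D" "xs ! Suc m \<in> D" using xs step nth_mem by fastforce+
    ultimately have "\<delta> \<le> xs ! Suc m - xs ! m" using sep[of "xs ! m" "xs ! Suc m"] by auto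
    then show ?case using step by (simp add: algebra_simps)
  qed simp
  show ?thesis
  proof (rule that[of "\<lambda>i. xs ! i"])
    show "(\<lambda>i. xs ! i) ` {..<card D} = D"
      using xs by (auto simp: set_conv_nth image_def)
    show "\<delta> * \<bar>real i - real i'\<bar> \<le> \<bar>xs ! i - xs ! i'\<bar>" if "i < card D" "i' < card D" for i i'
      using mono[of i i'] mono[of i' i] that by (cases "i \<le> i'") (auto simp: abs_if)
  qed
qed

text \<open>Each digit set is taken so large, compared with everything chosen before it, that the
  factor \<open>base j ^ 4\<close> lost in the measure of the difference sets costs only an arbitrarily
  small amount in the Hoelder exponent.\<close>

lemma algebraic_sparse_set_exists:
  assumes "finite S" "\<And>s. s \<in> S \<Longrightarrow> algebraic s"
  obtains A h where "compact A" "\<forall>t\<in>{0..<1}. h t \<in> A"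
    "\<forall>s\<in>S. negligible (dilated_differences s A)"
    "\<forall>\<gamma>. 0 < \<gamma> \<longrightarrow> \<gamma> < 1 \<longrightarrow>
       (\<exists>G. \<forall>t\<in>{0..<1}. \<forall>t'\<in>{0..<1}. \<bar>t - t'\<bar> \<le> G * \<bar>h t - h t'\<bar> powr \<gamma>)"
proof -
  obtain c C :: real where c: "0 < c" "c \<le> 1" and ex:
    "\<And>n0::nat. \<exists>D::real set. finite D \<and> D \<subseteq> {0..1} \<and> n0 \<le> card D \<and>
       (\<forall>x\<in>D. \<forall>y\<in>D. x \<noteq> y \<longrightarrow> c / card D \<le> \<bar>x - y\<bar>) \<and>
       (\<forall>s\<in>S. card (dilated_differences s D) \<le> C * card D)"
    using separated_set_few_dilated_differences[OF assms] by blast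
  let ?P = "\<lambda>n0 D. finite D \<and> D \<subseteq> {0..1} \<and> n0 \<le> card D \<and>
       (\<forall>x\<in>D. \<forall>y\<in>D. x \<noteq> y \<longrightarrow> c / card D \<le> \<bar>x - y\<bar>) \<and>
       (\<forall>s\<in>S. card (dilated_differences s D) \<le> C * card D)"
  have "\<forall>n0::nat. \<exists>D::real set. ?P n0 D" using ex by blast
  from choice[OF this] obtain X where X_all: "\<forall>n0. ?P n0 (X n0)" by (elim exE)
  have X: "finite (X n0)" "X n0 \<subseteq> {0..1}" "n0 \<le> card (X n0)"
      "x \<in> X n0 \<Longrightarrow> y \<in> X n0 \<Longrightarrow> x \<noteq> y \<Longrightarrow> c / card (X n0) \<le> \<bar>x - y\<bar>"
      "s \<in> S \<Longrightarrow> card (dilated_differences s (X n0)) \<le> C * card (X n0)" for n0 x y s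
    using X_all[rule_format, of n0] by blast+
  \<comment> \<open>The next scale times the next digit count. Division by \<open>b ^ 4\<close> and
    \<open>j + 1\<close> sends the measure of the covers to 0; the factor \<open>c / 4\<close>
    serves \<open>r_Suc\<close>.\<close>
  define K where "K j \<rho> b = c * \<rho> / 4 / (real (j + 1) * real b ^ 4)" for j b :: nat and \<rho> :: real
  \<comment> \<open>With this many digits, \<open>1 / K\<close> is at most the root of order
    \<open>j + 1\<close> of their number, so the next scale loses little in the exponent against the
    reciprocal of that number.\<close>
  define n0 where "n0 j \<rho> b = max 2 (nat \<lceil>(1 / K j \<rho> b) ^ (j + 1)\<rceil>)" for j b :: nat and \<rho> :: real
  \<comment> \<open>The recursion carries the current scale and the product of the earlier digit
    counts, which is later identified with \<open>base j\<close>.\<close>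
  define st where "st = rec_nat (1 :: real, 1 :: nat)
    (\<lambda>j (\<rho>, b). (K j \<rho> b / card (X (n0 j \<rho> b)), b * card (X (n0 j \<rho> b))))"
  define r where "r j = fst (st j)" for j
  define b where "b j = snd (st j)" for j
  define D where "D j = X (n0 j (r j) (b j))" for j
  define n where "n j = card (D j)" for j
  have r0: "r 0 = 1" and b0: "b 0 = 1" by (simp_all add: r_def b_def st_def)
  have rS: "r (Suc j) = K j (r j) (b j) / n j" and bS: "b (Suc j) = b j * n j" for j
    by (simp_all add: r_def b_def n_def D_def st_def case_prod_unfold)
  have n_ge: "n0 j (r j) (b j) \<le> n j" for j using X(3) by (simp add: n_def D_def)
  then have n2: "2 \<le> n j" for j by (auto simp: n0_def intro: order_trans[OF max.cobounded1])
  have b_pos: "0 < b j" for j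
  proof (induction j)
    case (Suc j)
    then show ?case using n2[of j] by (simp add: bS)
  qed (simp add: b0)
  have r_pos: "0 < r j" for j
  proof (induction j)
    case (Suc j)
    have "0 < real (n j)" using n2[of j] by simp
    with Suc c b_pos[of j] show ?case by (simp add: rS K_def)
  qed (simp add: r0)
  have K_pos: "0 < K j (r j) (b j)" for j using c b_pos r_pos by (simp add: K_def)
  have "\<exists>p. p ` {..<n j} = D j \<and>
      (\<forall>i<n j. \<forall>i'<n j. c / n j * \<bar>real i - real i'\<bar> \<le> \<bar>p i - p i'\<bar>)" for j
  proof -
    obtain p where "p ` {..<card (D j)} = D j"
      "\<And>i i'. i < card (D j) \<Longrightarrow> i' < card (D j) \<Longrightarrow> c / card (D j) * \<bar>real i - real i'\<bar> \<le> \<bar>p i - p i'\<bar>"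
      by (rule sorted_enumeration_separated[of "D j" "c / card (D j)"]) (auto simp: D_def X)
    then show ?thesis unfolding n_def by blast
  qed
  then have "\<forall>j. \<exists>p. p ` {..<n j} = D j \<and>
      (\<forall>i<n j. \<forall>i'<n j. c / n j * \<bar>real i - real i'\<bar> \<le> \<bar>p i - p i'\<bar>)" by blast
  from choice[OF this] obtain p where p: "\<And>j. p j ` {..<n j} = D j"
      "\<And>j i i'. i < n j \<Longrightarrow> i' < n j \<Longrightarrow> c / n j * \<bar>real i - real i'\<bar> \<le> \<bar>p j i - p j i'\<bar>"
    by blast
  interpret digit_expansion n p r c
  proof
    show "p j i \<in> {0..1}" if "i < n j" for i j
    proof -
      have "p j i \<in> D j" using p(1)[of j] that by blast
      then show ?thesis using X(2) unfolding D_def by blast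
    qed
    show "r (Suc j) \<le> c * r j / (4 * n j)" for j
    proof -
      have "1 * 1 \<le> real (j + 1) * real (b j) ^ 4"
        using b_pos[of j] by (intro mult_mono one_le_power) auto
      then have "c * r j / 4 / (real (j + 1) * real (b j) ^ 4) \<le> c * r j / 4 / 1"
        using c r_pos[of j] by (intro divide_left_mono) auto
      then have "K j (r j) (b j) \<le> c * r j / 4" by (simp only: K_def div_by_1)
      then have "K j (r j) (b j) / n j \<le> c * r j / 4 / n j" by (intro divide_right_mono) auto
      then show ?thesis by (simp add: rS)
    qed
  qed (use n2 r_pos c p in auto)
  have base: "base j = b j" for j
    by (induction j) (simp_all add: base_0 base_Suc b0 bS)
  have negl: "negligible (dilated_differences s attractor)" if "s \<in> S" for s
  proof (rule negligible_dilated_differences_attractor[where C = C])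
    show "card (dilated_differences s (p j ` {..<n j})) \<le> C * n j" for j
      unfolding p(1) unfolding n_def D_def by (rule X(5)[OF that])
    have eq: "base j ^ 4 * n j * r (Suc j) = c * r j / 4 / real (j + 1)" for j
      using b_pos[of j] n2[of j] by (simp add: base rS K_def)
    have le: "c * r j / 4 / real (j + 1) \<le> 1 / real (j + 1)" for j
    proof -
      have "r j \<le> 1" using r_add_le[of j 0] power_le_one[of "1/4::real" j] by (simp add: r0)
      then have "c * r j \<le> 1 * 1" using c r_pos[of j] by (intro mult_mono) auto
      then show ?thesis by (intro divide_right_mono) auto
    qed
    have ge: "0 \<le> c * r j / 4 / real (j + 1)" for j using c r_pos[of j] by simp
    have "(\<lambda>j. 1 / real (j + 1)) \<longlonglongrightarrow> 0"
      using LIMSEQ_inverse_real_of_nat by (simp add: inverse_eq_divide)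
    then show "(\<lambda>j. base j ^ 4 * n j * r (Suc j)) \<longlonglongrightarrow> 0"
      unfolding eq
      by (rule real_tendsto_sandwich[OF always_eventually[OF allI[OF ge]] always_eventually[OF allI[OF le]] tendsto_const])
  qed
  \<comment> \<open>The choice of \<open>n0\<close> gives
    \<open>1 / r (Suc j) \<le> n j powr (1 + 1 / (j + 1))\<close>, so any \<open>\<gamma>\<close>
    below 1 is admissible once \<open>j\<close> is large.\<close>
  have r_ge: "1 / base (Suc j) \<le> r (Suc j) powr \<gamma>" if "0 < \<gamma>" "\<gamma> * (1 + 1 / real (j + 1)) \<le> 1" for j \<gamma>
  proof -
    let ?K = "K j (r j) (b j)"
    have n1: "1 \<le> real (n j)" using n2[of j] by simp
    have "(1 / ?K) ^ (j + 1) \<le> n j" using n_ge[of j] by (simp add: n0_def)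
    then have "((1 / ?K) ^ (j + 1)) powr (1 / real (j + 1)) \<le> real (n j) powr (1 / real (j + 1))"
      using K_pos[of j] by (intro powr_mono2) auto
    also have "((1 / ?K) ^ (j + 1)) powr (1 / real (j + 1)) = 1 / ?K"
    proof -
      have "(1 / ?K) ^ (j + 1) = (1 / ?K) powr real (j + 1)"
        using K_pos[of j] by (intro powr_realpow[symmetric]) auto
      then show ?thesis using K_pos[of j] by (simp only: powr_powr) (simp del: of_nat_Suc)
    qed
    finally have "1 / ?K \<le> real (n j) powr (1 / real (j + 1))" .
    then have "1 / r (Suc j) \<le> real (n j) powr (1 / real (j + 1)) * real (n j)"
      using n1 mult_right_mono[of "1 / ?K" _ "real (n j)"] by (simp add: rS)
    also have "\<dots> = real (n j) powr (1 + 1 / real (j + 1))"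
      using n1 by (simp add: powr_add mult.commute)
    finally have "(1 / r (Suc j)) powr \<gamma> \<le> (real (n j) powr (1 + 1 / real (j + 1))) powr \<gamma>"
      using that r_pos[of "Suc j"] by (intro powr_mono2) auto
    also have "\<dots> = real (n j) powr (\<gamma> * (1 + 1 / real (j + 1)))" by (simp add: powr_powr mult.commute)
    also have "\<dots> \<le> real (n j) powr 1" using that n1 by (intro powr_mono) auto
    also have "\<dots> \<le> base (Suc j)"
    proof -
      have "1 * n j \<le> b j * n j" using b_pos[of j] by (intro mult_mono) auto
      then have "real (n j) \<le> real (b j * n j)" by (subst of_nat_le_iff) simp
      then show ?thesis using n1 by (simp add: base bS)
    qed
    finally have "1 / (r (Suc j) powr \<gamma>) \<le> base (Suc j)"
      using r_pos[of "Suc j"] by (simp add: powr_divide)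
    then show ?thesis using r_pos[of "Suc j"] base_pos[of "Suc j"] by (simp add: field_simps)
  qed
  have hoelder: "\<exists>G. \<forall>t\<in>{0..<1}. \<forall>t'\<in>{0..<1}. \<bar>t - t'\<bar> \<le> G * \<bar>expansion t - expansion t'\<bar> powr \<gamma>"
    if \<gamma>: "0 < \<gamma>" "\<gamma> < 1" for \<gamma>
  proof -
    have "(\<lambda>j. \<gamma> * (1 + 1 / real (Suc j))) \<longlonglongrightarrow> \<gamma> * (1 + 0)"
      using LIMSEQ_inverse_real_of_nat by (intro tendsto_intros) (simp add: inverse_eq_divide)
    then have "eventually (\<lambda>j. \<gamma> * (1 + 1 / real (Suc j)) < 1) sequentially"
      using \<gamma> by (intro order_tendstoD(2)[where y = "\<gamma> * (1 + 0)"]) auto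
    then obtain J where J': "\<forall>j\<ge>J. \<gamma> * (1 + 1 / real (Suc j)) < 1"
      unfolding eventually_sequentially by blast
    have J: "\<gamma> * (1 + 1 / real (j + 1)) \<le> 1" if "J \<le> j" for j
      using J'[rule_format, OF that] by (simp add: less_imp_le)
    \<comment> \<open>The sum takes care of the finitely many \<open>j \<le> J\<close>, the summand
      1 of the later ones through \<open>r_ge\<close>.\<close>
    define G where "G = 1 + (\<Sum>j\<le>J. 1 / (base j * r j powr \<gamma>))"
    have G1: "1 \<le> G" by (simp add: G_def sum_nonneg)
    have G: "1 / base j \<le> G * r j powr \<gamma>" for j
    proof (cases "j \<le> J")
      case True
      then have "1 / (base j * r j powr \<gamma>) \<le> (\<Sum>j\<le>J. 1 / (base j * r j powr \<gamma>))"
        by (intro member_le_sum[of j _ "\<lambda>j. 1 / (base j * r j powr \<gamma>)"]) auto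
      then have "1 / (base j * r j powr \<gamma>) \<le> G" by (simp add: G_def)
      moreover have "0 < r j powr \<gamma>" using r_pos[of j] by simp
      ultimately show ?thesis using base_pos[of j] by (simp add: field_simps)
    next
      case False
      then obtain i where i: "j = Suc i" "J \<le> i" by (cases j) auto
      have "1 / base j \<le> r j powr \<gamma>" unfolding i(1) by (rule r_ge[OF \<gamma>(1) J[OF i(2)]])
      also have "\<dots> \<le> G * r j powr \<gamma>" using mult_right_mono[OF G1, of "r j powr \<gamma>"] by simp
      finally show ?thesis .
    qed
    show ?thesis
      by (intro exI[of _ "2 * G * (2 / c) powr \<gamma>"] ballI expansion_hoelder[OF \<gamma>(1) _ G])
         (use \<gamma> in auto)
  qed
  have "\<forall>t\<in>{0..<1}. expansion t \<in> attractor"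
    by (auto simp: attractor_def intro: subsetD[OF closure_subset])
  then show thesis
    using compact_attractor negl hoelder by (intro that) auto
qed

section \<open>Planar norms with polygonal unit ball\<close>

lemma plane_axis_decomposition: "(x :: real^2) = (x $ 1) *\<^sub>R axis 1 1 + (x $ 2) *\<^sub>R axis 2 1"
  by (simp add: Finite_Cartesian_Product.vec_eq_iff forall_2 axis_def)

text \<open>Rescaling into the bounded unit ball bounds \<open>norm\<close> by \<open>N\<close>; the
  triangle inequality along the coordinate axes gives the converse.\<close>

lemma is_norm_equivalent_norm:
  fixes N :: "real ^ 2 \<Rightarrow> real"
  assumes N: "is_norm N" and "bounded (norm_unit_ball N)"
  obtains K where "K > 0" "\<And>x. norm x \<le> K * N x" "\<And>x. N x \<le> K * norm x"
proof -
  have scale: "N (c *\<^sub>R x) = \<bar>c\<bar> * N x" and tri: "N (x + y) \<le> N x + N y" and zero: "N x = 0 \<longleftrightarrow> x = 0" for c x y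
    using N by (auto simp: is_norm_def)
  obtain K1 where K1: "K1 > 0" "\<And>x. x \<in> norm_unit_ball N \<Longrightarrow> norm x \<le> K1"
    using assms(2) by (auto simp: bounded_pos)
  define K2 where "K2 = N (axis 1 1) + N (axis 2 1)"
  have "norm x \<le> K1 * N x" for x
  proof (cases "x = 0")
    case False
    then have "N x > 0" using zero[of x] is_norm_nonneg[OF N, of x] by linarith
    then have "(1 / N x) *\<^sub>R x \<in> norm_unit_ball N" by (simp add: norm_unit_ball_def scale)
    from K1(2)[OF this] \<open>N x > 0\<close> show ?thesis by (simp add: field_simps)
  qed (use is_norm_nonneg[OF N, of 0] K1 in auto)
  moreover have "N x \<le> K2 * norm x" for x
  proof -
    have "N x \<le> N ((x $ 1) *\<^sub>R axis 1 1) + N ((x $ 2) *\<^sub>R axis 2 1)"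
      using tri by (subst plane_axis_decomposition[of x])
    also have "\<dots> \<le> norm x * N (axis 1 1) + norm x * N (axis 2 1)"
      unfolding scale by (intro add_mono mult_right_mono is_norm_nonneg[OF N]) (simp_all add: component_le_norm_cart)
    finally show ?thesis by (simp add: K2_def algebra_simps)
  qed
  moreover have "K1 * N x \<le> max K1 K2 * N x" "K2 * norm x \<le> max K1 K2 * norm x" for x
    by (intro mult_right_mono; simp add: is_norm_nonneg[OF N])+
  ultimately show ?thesis using K1(1) by (intro that[of "max K1 K2"]) (meson less_max_iff_disj order_trans)+
qed

text \<open>The bound makes sets open for \<open>N\<close> open in the usual sense, and compactness
  passes to the coarser topology.\<close>

lemma compactin_norm_dist:
  fixes N :: "real ^ 2 \<Rightarrow> real"
  assumes N: "is_norm N" and K: "\<And>x. N x \<le> K * norm x" and A: "compact A"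
  shows "compactin (Metric_space.mtopology UNIV (norm_dist N)) A"
proof -
  interpret Metric_space UNIV "norm_dist N" by (rule Metric_space_norm_dist[OF N])
  show ?thesis
  proof (rule compactin_contractive)
    show "compactin euclidean A" using A by simp
    show "topspace euclidean = topspace mtopology" by simp
    show "openin euclidean U" if U: "openin mtopology U" for U
      unfolding open_openin[symmetric] open_dist
    proof
      fix x assume "x \<in> U"
      then obtain e where e: "e > 0" "mball x e \<subseteq> U" using U by (auto simp: openin_mtopology)
      have "y \<in> U" if "dist y x < e / (\<bar>K\<bar> + 1)" for y
      proof -
        have "N (x - y) \<le> K * norm (x - y)" by (rule K)
        also have "\<dots> \<le> (\<bar>K\<bar> + 1) * norm (x - y)" by (intro mult_right_mono) auto
        also have "\<dots> < e"
          using that pos_less_divide_eq[of "\<bar>K\<bar> + 1" "norm (x - y)" e]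
          by (simp add: dist_norm norm_minus_commute mult.commute add_nonneg_pos)
        finally show ?thesis using e(2) by (auto simp: norm_dist_def)
      qed
      then show "\<exists>e>0. \<forall>y. dist y x < e \<longrightarrow> y \<in> U"
        using e(1) by (intro exI[of _ "e / (\<bar>K\<bar> + 1)"]) auto
    qed
  qed
qed

lemma zero_in_interior_norm_unit_ball:
  fixes N :: "real ^ 2 \<Rightarrow> real"
  assumes "\<And>x. N x \<le> K * norm x" "K > 0"
  shows "0 \<in> interior (norm_unit_ball N)"
proof -
  have "ball 0 (1 / K) \<subseteq> norm_unit_ball N"
  proof
    fix x :: "real^2" assume "x \<in> ball 0 (1 / K)"
    then have "K * norm x \<le> 1" using assms(2) by (simp add: field_simps)
    then show "x \<in> norm_unit_ball N" using assms(1)[of x] by (simp add: norm_unit_ball_def)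
  qed
  then show ?thesis using assms(2) by (intro interiorI[of "ball 0 (1/K)"]) auto
qed

text \<open>The rescaled point has \<open>N\<close>-value 1 and leaves the ball when stretched
  slightly, so it lies on the relative boundary. That boundary is the union of the facets, which in
  dimension 2 are the edges.\<close>

lemma radial_projection_in_edge:
  fixes N :: "real ^ 2 \<Rightarrow> real"
  assumes N: "is_norm N" and poly: "polytope (norm_unit_ball N)" and "x \<noteq> 0"
  obtains F where "F edge_of norm_unit_ball N" "(1 / N x) *\<^sub>R x \<in> F"
proof -
  have scale: "N (c *\<^sub>R x) = \<bar>c\<bar> * N x" for c x using N by (auto simp: is_norm_def)
  obtain K where K: "K > 0" "\<And>x. norm x \<le> K * N x" "\<And>x. N x \<le> K * norm x"
    using is_norm_equivalent_norm[OF N polytope_imp_bounded[OF poly]] by blast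
  have int0: "0 \<in> interior (norm_unit_ball N)"
    by (rule zero_in_interior_norm_unit_ball[OF K(3) K(1)])
  then have ne: "interior (norm_unit_ball N) \<noteq> {}" by blast
  have "N x > 0" using assms(3) is_norm_nonneg[OF N, of x] N by (auto simp: is_norm_def less_le)
  define y where "y = (1 / N x) *\<^sub>R x"
  have "N y = 1" using \<open>N x > 0\<close> by (simp add: y_def scale)
  then have "y \<in> norm_unit_ball N" by (simp add: norm_unit_ball_def)
  moreover have "y \<notin> rel_interior (norm_unit_ball N)"
  proof
    assume "y \<in> rel_interior (norm_unit_ball N)"
    then have "y \<in> interior (norm_unit_ball N)" using rel_interior_nonempty_interior[OF ne] by simp
    then obtain e where e: "e > 0" "ball y e \<subseteq> norm_unit_ball N" by (auto simp: mem_interior)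
    define \<epsilon> where "\<epsilon> = e / (2 * (norm y + 1))"
    have "norm y + 1 > 0" by (simp add: add_nonneg_pos)
    have "\<epsilon> > 0" using e \<open>norm y + 1 > 0\<close> by (simp add: \<epsilon>_def)
    have "dist y ((1 + \<epsilon>) *\<^sub>R y) = \<epsilon> * norm y" using \<open>\<epsilon> > 0\<close> by (simp add: dist_norm algebra_simps)
    also have "\<dots> \<le> \<epsilon> * (norm y + 1)" using \<open>\<epsilon> > 0\<close> by (intro mult_left_mono) auto
    also have "\<dots> = e / 2" using \<open>norm y + 1 > 0\<close> by (simp add: \<epsilon>_def field_simps)
    also have "\<dots> < e" using e by simp
    finally have "(1 + \<epsilon>) *\<^sub>R y \<in> norm_unit_ball N" using e(2) by auto
    then show False using \<open>N y = 1\<close> \<open>\<epsilon> > 0\<close> by (simp add: norm_unit_ball_def scale)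
  qed
  ultimately have "y \<in> \<Union> {F. F facet_of norm_unit_ball N}"
    using rel_boundary_of_polyhedron[OF polytope_imp_polyhedron[OF poly]] by blast
  then obtain F where F: "F facet_of norm_unit_ball N" "y \<in> F" by blast
  have "aff_dim (norm_unit_ball N) = 2" using aff_dim_nonempty_interior[OF ne] by simp
  then have "F edge_of norm_unit_ball N" using F(1) by (simp add: facet_of_def edge_of_def)
  with F(2) show ?thesis by (intro that) (auto simp: y_def)
qed

text \<open>Inserting \<open>x / N x\<close> into the equation of the line through the edge shows
  that \<open>- u0 * N x\<close> is a linear form on the whole cone; it remains to divide by
  \<open>u0\<close>.\<close>

lemma norm_on_edge_cone:
  fixes N :: "real ^ 2 \<Rightarrow> real"
  assumes N: "is_norm N" and poly: "polytope (norm_unit_ball N)"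
    and F: "F edge_of norm_unit_ball N" and slope: "has_slope F m"
  obtains c where "\<And>x. x \<noteq> 0 \<Longrightarrow> (1 / N x) *\<^sub>R x \<in> F \<Longrightarrow>
    N x = c * (if m = \<infinity> then x $ 1 else x $ 2 - real_of_ereal m * x $ 1)"
proof -
  obtain K where K: "K > 0" "\<And>x. norm x \<le> K * N x" "\<And>x. N x \<le> K * norm x"
    using is_norm_equivalent_norm[OF N polytope_imp_bounded[OF poly]] by blast
  have int0: "0 \<in> interior (norm_unit_ball N)"
    by (rule zero_in_interior_norm_unit_ball[OF K(3) K(1)])
  then have ne: "interior (norm_unit_ball N) \<noteq> {}" by blast
  obtain u0 u1 u2 where u: "(u1, u2) \<noteq> (0, 0)"
      "F \<subseteq> {x. u1 * x $ 1 + u2 * x $ 2 + u0 = 0}"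
      "m = (if u2 = 0 then \<infinity> else ereal (- u1 / u2))"
    using slope unfolding has_slope_def by blast
  define v :: "real^2" where "v = vector [u1, u2]"
  have "v \<noteq> 0" using u(1) by (auto simp: v_def Finite_Cartesian_Product.vec_eq_iff forall_2)
  have line: "{x. u1 * x $ 1 + u2 * x $ 2 + u0 = 0} = {x. v \<bullet> x = - u0}"
    by (auto simp: v_def inner_vec_def sum_2)
  have face: "F face_of norm_unit_ball N" "aff_dim F = 1" using F by (auto simp: edge_of_def)
  \<comment> \<open>Otherwise the affine hull of the edge, being the whole line, would contain the
    interior point 0, whereas the affine hull of a proper face avoids the relative interior.\<close>
  have "u0 \<noteq> 0"
  proof
    assume "u0 = 0"
    have "affine hull F \<subseteq> {x. v \<bullet> x = - u0}"
      using u(2) by (intro hull_minimal) (auto simp: line affine_hyperplane)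
    moreover have "aff_dim {x. v \<bullet> x = - u0} = 1" using \<open>v \<noteq> 0\<close> by (simp add: aff_dim_hyperplane)
    ultimately have "affine hull F = {x. v \<bullet> x = - u0}"
      using face(2) by (intro affine_dim_equal) (auto simp: affine_hyperplane)
    then have "0 \<in> affine hull F" using \<open>u0 = 0\<close> by simp
    moreover have "F \<noteq> norm_unit_ball N"
      using face(2) aff_dim_nonempty_interior[OF ne] by auto
    then have "affine hull F \<inter> rel_interior (norm_unit_ball N) = {}"
      using affine_hull_face_of_disjoint_rel_interior[OF polytope_imp_convex[OF poly] face(1)] by blast
    moreover have "0 \<in> rel_interior (norm_unit_ball N)" using int0 interior_subset_rel_interior by blast
    ultimately show False by blast
  qed
  have eq: "u1 * x $ 1 + u2 * x $ 2 = - u0 * N x" if "x \<noteq> 0" "(1 / N x) *\<^sub>R x \<in> F" for x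
  proof -
    have "N x \<noteq> 0" using N that(1) by (auto simp: is_norm_def)
    moreover have "u1 * (x $ 1 / N x) + u2 * (x $ 2 / N x) + u0 = 0" using u(2) that(2) by auto
    ultimately show ?thesis by (simp add: field_simps)
  qed
  show ?thesis
  proof (cases "u2 = 0")
    case True
    then have "N x = - u1 / u0 * x $ 1" if "x \<noteq> 0" "(1 / N x) *\<^sub>R x \<in> F" for x
      using eq[OF that] \<open>u0 \<noteq> 0\<close> by (simp add: field_simps)
    then show ?thesis using True u(3) by (intro that[of "- u1 / u0"]) auto
  next
    case False
    then have "N x = - u2 / u0 * (x $ 2 + u1 / u2 * x $ 1)" if "x \<noteq> 0" "(1 / N x) *\<^sub>R x \<in> F" for x
      using eq[OF that] \<open>u0 \<noteq> 0\<close> by (simp add: field_simps)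
    then show ?thesis using False u(3) by (intro that[of "- u2 / u0"]) auto
  qed
qed

section \<open>Hausdorff dimension of product sets\<close>

lemma diam_le:
  assumes "\<And>x y. x \<in> U \<Longrightarrow> y \<in> U \<Longrightarrow> d x y \<le> D"
  shows "diam d U \<le> ennreal D"
  unfolding diam_def using assms by (intro SUP_least ennreal_leI) auto

text \<open>\<open>enn2real\<close> sends infinity to 0, a case that finiteness of the diameter
  excludes.\<close>

lemma le_enn2real_diam:
  assumes "x \<in> U" "y \<in> U" "diam d U < \<infinity>"
  shows "d x y \<le> enn2real (diam d U)"
proof -
  have "ennreal (d x y) \<le> diam d U"
    unfolding diam_def using assms(1,2) by (intro SUP_upper2[of x] SUP_upper2[of y]) auto
  then show ?thesis using assms(3) by (simp add: ennreal_enn2real ennreal_le_iff2 flip: ennreal_le_iff)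
qed

text \<open>In dimension 0 a single point has weight 1 although \<open>0 powr 0 = 0\<close>, hence
  \<open>0 < s\<close>.\<close>

lemma diam_power_le:
  assumes "diam d U \<le> ennreal D" "0 \<le> D" "0 < s"
  shows "diam_power d s U \<le> ennreal (D powr s)"
proof -
  have "enn2real (diam d U) \<le> D" using assms(1,2) by (simp add: enn2real_leI)
  then have "enn2real (diam d U) powr s \<le> D powr s" using assms(3) by (intro powr_mono2) auto
  then show ?thesis using assms(3) by (simp add: diam_power_def ennreal_leI)
qed

text \<open>The finite cover is padded to a sequence by empty sets, whose weight is 0.\<close>

lemma hausdorff_premeasure_le_finite_cover:
  assumes "finite I" "A \<subseteq> (\<Union>i\<in>I. V i)" "\<And>i. i \<in> I \<Longrightarrow> diam d (V i) \<le> ennreal \<delta>"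
  shows "hausdorff_premeasure d s \<delta> A \<le> (\<Sum>i\<in>I. diam_power d s (V i))"
proof -
  obtain e where e: "bij_betw e {..<card I} I"
    using ex_bij_betw_nat_finite[OF assms(1)] by (auto simp: atLeast0LessThan)
  define U where "U j = (if j < card I then V (e j) else {})" for j
  have "A \<subseteq> (\<Union>j. U j)"
  proof
    fix x assume "x \<in> A"
    then obtain i where i: "i \<in> I" "x \<in> V i" using assms(2) by auto
    then have "i \<in> e ` {..<card I}" using e by (simp add: bij_betw_def)
    with i show "x \<in> (\<Union>j. U j)" by (auto simp: U_def)
  qed
  moreover have "diam d (U j) \<le> ennreal \<delta>" for j
    using e assms(3) by (auto simp: U_def bij_betw_def diam_def)
  ultimately have "hausdorff_premeasure d s \<delta> A \<le> (\<Sum>j. diam_power d s (U j))"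
    unfolding hausdorff_premeasure_def by (intro INF_lower) auto
  also have "\<dots> = (\<Sum>j<card I. diam_power d s (U j))"
    by (intro suminf_finite) (auto simp: U_def diam_power_def)
  also have "\<dots> = (\<Sum>j<card I. diam_power d s (V (e j)))" by (simp add: U_def)
  also have "\<dots> = (\<Sum>i\<in>I. diam_power d s (V i))" by (rule sum.reindex_bij_betw[OF e])
  finally show ?thesis .
qed

text \<open>A grid of mesh \<open>1 / k\<close> covers \<open>A\<close> by at most
  \<open>9 * M ^ 2 * k ^ 2\<close> cells of diameter at most \<open>2 * K / k\<close>; the sum of
  the powers is of order \<open>k powr (2 - s)\<close> and tends to 0.\<close>

lemma hausdorff_measure_plane_eq_0:
  fixes N :: "real ^ 2 \<Rightarrow> real" and A :: "(real ^ 2) set"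
  assumes "bounded A" and K: "K > 0" "\<And>x. N x \<le> K * norm x" and "2 < s"
  shows "hausdorff_measure (norm_dist N) s A = 0"
proof -
  obtain R where "\<And>x. x \<in> A \<Longrightarrow> norm x \<le> R" using assms(1) by (auto simp: bounded_iff)
  then obtain M :: nat where M: "M \<ge> 1" "\<And>x. x \<in> A \<Longrightarrow> norm x \<le> M"
    by (metis linorder_le_cases of_nat_1 of_nat_le_iff order_trans real_arch_simple)
  have "hausdorff_premeasure (norm_dist N) s \<delta> A = 0" if "\<delta> > 0" for \<delta>
  proof -
    define f where "f k = (9 * real M ^ 2 * (2 * K) powr s) * real k powr (2 - s)" for k :: nat
    have "f \<longlonglongrightarrow> (9 * real M ^ 2 * (2 * K) powr s) * 0"
      unfolding f_def using \<open>2 < s\<close>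
      by (intro tendsto_intros tendsto_neg_powr filterlim_real_sequentially) auto
    then have "(\<lambda>k. ennreal (f k)) \<longlonglongrightarrow> ennreal 0" by (intro tendsto_ennrealI) simp
    moreover have "\<exists>k0. \<forall>k\<ge>k0. hausdorff_premeasure (norm_dist N) s \<delta> A \<le> ennreal (f k)"
    proof (intro exI allI impI)
      \<comment> \<open>For such \<open>k\<close> the cell diameter \<open>2 * K / k\<close> is at
        most \<open>\<delta>\<close>.\<close>
      fix k :: nat assume k: "k \<ge> nat \<lceil>2 * K / \<delta>\<rceil> + 1"
      then have k0: "k \<ge> 1" by simp
      have "2 * K / \<delta> \<le> k" using k by linarith
      then have k\<delta>: "2 * K / k \<le> \<delta>" using \<open>\<delta> > 0\<close> k0 by (simp add: field_simps)
      define m where "m = M * k"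
      define J where "J = {- int m..int m}"
      define V where "V = (\<lambda>(a::int, b::int). {x :: real^2. \<lfloor>x $ 1 * k\<rfloor> = a \<and> \<lfloor>x $ 2 * k\<rfloor> = b})"
      have J: "\<lfloor>t * k\<rfloor> \<in> J" if "\<bar>t\<bar> \<le> M" for t :: real
      proof -
        have "\<bar>t\<bar> * k \<le> real M * real k" using that by (intro mult_right_mono) auto
        then have "\<bar>t * k\<bar> \<le> m" by (simp add: abs_mult m_def)
        then show ?thesis unfolding J_def by (simp add: le_floor_iff floor_le_iff) linarith
      qed
      have "A \<subseteq> (\<Union>i\<in>J \<times> J. V i)"
      proof
        fix x assume "x \<in> A"
        then have "\<bar>x $ 1\<bar> \<le> M" "\<bar>x $ 2\<bar> \<le> M"
          using M(2) component_le_norm_cart order_trans by blast+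
        then have "x \<in> V (\<lfloor>x $ 1 * k\<rfloor>, \<lfloor>x $ 2 * k\<rfloor>)" "(\<lfloor>x $ 1 * k\<rfloor>, \<lfloor>x $ 2 * k\<rfloor>) \<in> J \<times> J"
          using J by (auto simp: V_def)
        then show "x \<in> (\<Union>i\<in>J \<times> J. V i)" by blast
      qed
      moreover have diam: "diam (norm_dist N) (V i) \<le> ennreal (2 * K / k)" for i
      proof (rule diam_le)
        fix x y assume "x \<in> V i" "y \<in> V i"
        then have "\<lfloor>x $ 1 * k\<rfloor> = \<lfloor>y $ 1 * k\<rfloor>" "\<lfloor>x $ 2 * k\<rfloor> = \<lfloor>y $ 2 * k\<rfloor>" by (auto simp: V_def)
        then have "\<bar>x $ 1 * k - y $ 1 * k\<bar> \<le> 1" "\<bar>x $ 2 * k - y $ 2 * k\<bar> \<le> 1" by linarith+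
        then have "\<bar>(x $ i - y $ i) * k\<bar> \<le> 1" for i
          using exhaust_2[of i] by (auto simp: left_diff_distrib)
        then have *: "\<bar>(x - y) $ i\<bar> \<le> 1 / k" for i
          using k0 by (simp add: abs_mult pos_le_divide_eq)
        have "norm (x - y) \<le> (\<Sum>i\<in>UNIV. \<bar>(x - y) $ i\<bar>)" by (rule norm_le_l1_cart)
        also have "\<dots> \<le> (\<Sum>i\<in>(UNIV::2 set). 1 / k)" by (intro sum_mono *)
        finally have "K * norm (x - y) \<le> K * (2 / k)" using K(1) by (intro mult_left_mono) auto
        then show "norm_dist N x y \<le> 2 * K / k"
          using K(2)[of "x - y"] by (simp add: norm_dist_def mult.commute)
      qed
      ultimately have "hausdorff_premeasure (norm_dist N) s \<delta> A \<le> (\<Sum>i\<in>J \<times> J. diam_power (norm_dist N) s (V i))"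
        by (intro hausdorff_premeasure_le_finite_cover order_trans[OF diam ennreal_leI[OF k\<delta>]])
           (auto simp: J_def)
      also have "\<dots> \<le> (\<Sum>i\<in>J \<times> J. ennreal ((2 * K / k) powr s))"
        using \<open>2 < s\<close> K(1) by (intro sum_mono diam_power_le diam) auto
      also have "\<dots> = ennreal (real (card (J \<times> J)) * (2 * K / k) powr s)"
        by (simp add: ennreal_mult ennreal_of_nat_eq_real_of_nat)
      also have "\<dots> \<le> ennreal (f k)"
      proof (rule ennreal_leI)
        have "card J = 2 * m + 1" by (simp add: J_def nat_add_distrib nat_mult_distrib)
        moreover have "1 * 1 \<le> m" unfolding m_def using M(1) k0 by (intro mult_mono) auto
        ultimately have "card J \<le> 3 * M * k" by (simp add: m_def)
        then have "card J * card J \<le> (3 * M * k) * (3 * M * k)" by (intro mult_mono) auto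
        then have "card (J \<times> J) \<le> 9 * M ^ 2 * k ^ 2"
          by (simp add: card_cartesian_product power2_eq_square mult_ac)
        then have "real (card (J \<times> J)) \<le> real (9 * M ^ 2 * k ^ 2)" by (subst of_nat_le_iff)
        then have "real (card (J \<times> J)) * (2 * K / k) powr s \<le> (9 * real M ^ 2 * real k ^ 2) * (2 * K / k) powr s"
          by (intro mult_right_mono) auto
        also have "\<dots> = f k"
          using K(1) k0 by (simp add: f_def powr_divide powr_diff powr_realpow)
        finally show "real (card (J \<times> J)) * (2 * K / k) powr s \<le> f k" .
      qed
      finally show "hausdorff_premeasure (norm_dist N) s \<delta> A \<le> ennreal (f k)" .
    qed
    ultimately have "hausdorff_premeasure (norm_dist N) s \<delta> A \<le> ennreal 0" by (rule LIMSEQ_le_const)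
    then show ?thesis by simp
  qed
  then show ?thesis by (simp add: hausdorff_measure_def)
qed

text \<open>A Hoelder-type inverse of the map \<open>(t\<^sub>1, t\<^sub>2) \<mapsto> (h t\<^sub>1, h t\<^sub>2)\<close> carries covers of
  \<open>A \<times> A\<close> to covers of the unit square.\<close>

lemma hausdorff_measure_square_neq_0:
  fixes N :: "real ^ 2 \<Rightarrow> real" and A :: "real set" and h :: "real \<Rightarrow> real"
  assumes K: "K > 0" "\<And>x. norm x \<le> K * N x"
    and h: "\<forall>t\<in>{0..<1}. h t \<in> A"
    and hoelder: "\<forall>t\<in>{0..<1}. \<forall>t'\<in>{0..<1}. \<bar>t - t'\<bar> \<le> G * \<bar>h t - h t'\<bar> powr \<gamma>"
    and \<gamma>: "0 < \<gamma>" and s: "0 \<le> s" "s \<le> 2 * \<gamma>"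
  shows "hausdorff_measure (norm_dist N) s {x. x $ 1 \<in> A \<and> x $ 2 \<in> A} \<noteq> 0"
proof
  let ?E = "{x :: real^2. x $ 1 \<in> A \<and> x $ 2 \<in> A}"
  let ?d = "norm_dist N"
  \<comment> \<open>The points 0 and 1/2 make the left-hand side of the Hoelder inequality
    positive.\<close>
  have G: "0 \<le> G"
  proof -
    have "0 < \<bar>0 - 1/2 :: real\<bar>" by simp
    also have "\<dots> \<le> G * \<bar>h 0 - h (1/2)\<bar> powr \<gamma>"
      using hoelder[rule_format, of 0 "1/2"] by simp
    finally show ?thesis using powr_ge_zero[of "\<bar>h 0 - h (1/2)\<bar>" \<gamma>] by (auto simp: zero_less_mult_iff)
  qed
  \<comment> \<open>A covering set of diameter \<open>D\<close> pulls back into a square of side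
    \<open>2 * G * (K * D) powr \<gamma>\<close>, whose area is
    \<open>c * D powr (2 * \<gamma>)\<close>.\<close>
  define c where "c = (2 * G * K powr \<gamma>) ^ 2"
  have "c \<ge> 0" by (simp add: c_def)
  assume "hausdorff_measure ?d s ?E = 0"
  \<comment> \<open>Scale 1 is fine enough: for diameters up to 1 the exponent
    \<open>2 * \<gamma>\<close> may be lowered to \<open>s\<close>.\<close>
  moreover have "hausdorff_premeasure ?d s 1 ?E \<le> hausdorff_measure ?d s ?E"
    unfolding hausdorff_measure_def by (rule SUP_upper) simp
  \<comment> \<open>This threshold makes the total area at most \<open>c / (c + 1)\<close>, less
    than that of the unit square.\<close>
  moreover have "0 < ennreal (1 / (c + 1))" using \<open>c \<ge> 0\<close> by simp
  ultimately have "hausdorff_premeasure ?d s 1 ?E < ennreal (1 / (c + 1))" by simp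
  then obtain U where U': "U \<in> {U. ?E \<subseteq> (\<Union>i. U i) \<and> (\<forall>i. diam ?d (U i) \<le> ennreal 1)}"
      and small: "(\<Sum>i. diam_power ?d s (U i)) < ennreal (1 / (c + 1))"
    unfolding hausdorff_premeasure_def INF_less_iff by blast
  have U: "?E \<subseteq> (\<Union>i. U i)" "diam ?d (U i) \<le> ennreal 1" for i using U' by blast+
  define D where "D i = enn2real (diam ?d (U i))" for i
  have fin: "diam ?d (U i) < \<infinity>" for i using U(2)[of i] by (auto intro: le_less_trans)
  have D: "0 \<le> D i" "D i \<le> 1" for i
    using U(2)[of i] by (auto simp: D_def intro: enn2real_leI)
  define W where "W i = {x :: real^2. x $ 1 \<in> {0..<1} \<and> x $ 2 \<in> {0..<1} \<and> vector [h (x $ 1), h (x $ 2)] \<in> U i}" for i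
  have W_diff: "\<bar>x $ j - y $ j\<bar> \<le> G * (K * D i) powr \<gamma>" if "x \<in> W i" "y \<in> W i" for x y i j
  proof -
    have "x $ j \<in> {0..<1}" "y $ j \<in> {0..<1}"
      using that exhaust_2[of j] by (auto simp: W_def)
    then have "\<bar>x $ j - y $ j\<bar> \<le> G * \<bar>h (x $ j) - h (y $ j)\<bar> powr \<gamma>" using hoelder by blast
    also have "\<dots> \<le> G * (K * D i) powr \<gamma>"
    proof (intro mult_left_mono powr_mono2 G)
      let ?u = "vector [h (x $ 1), h (x $ 2)] :: real^2" and ?v = "vector [h (y $ 1), h (y $ 2)] :: real^2"
      have "\<bar>h (x $ j) - h (y $ j)\<bar> = \<bar>(?u - ?v) $ j\<bar>" using exhaust_2[of j] by auto
      also have "\<dots> \<le> norm (?u - ?v)" by (rule component_le_norm_cart)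
      also have "\<dots> \<le> K * N (?u - ?v)" by (rule K(2))
      also have "\<dots> \<le> K * D i"
        using le_enn2real_diam[of ?u "U i" ?v ?d] that fin[of i] K(1)
        by (intro mult_left_mono) (auto simp: W_def D_def norm_dist_def)
      finally show "\<bar>h (x $ j) - h (y $ j)\<bar> \<le> K * D i" .
    qed (use \<gamma> in auto)
    finally show ?thesis .
  qed
  \<comment> \<open>\<open>W i\<close> need not be measurable, so it is enclosed in a box centred at
    one of its points.\<close>
  have "\<exists>Q. Q \<in> sets lborel \<and> W i \<subseteq> Q \<and> emeasure lborel Q \<le> ennreal c * diam_power ?d s (U i)" for i
  proof (cases "W i = {}")
    case False
    then obtain a where a: "a \<in> W i" by blast
    define \<rho> where "\<rho> = G * (K * D i) powr \<gamma>"
    have "\<rho> \<ge> 0" using G by (simp add: \<rho>_def)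
    define l u where "l = (a - (\<chi> j. \<rho>))" and "u = (a + (\<chi> j. \<rho>))"
    have "W i \<subseteq> cbox l u"
    proof
      fix x assume x: "x \<in> W i"
      show "x \<in> cbox l u"
        unfolding mem_box_cart
      proof
        fix j
        show "l $ j \<le> x $ j \<and> x $ j \<le> u $ j"
          using W_diff[OF x a, of j] by (auto simp: l_def u_def \<rho>_def abs_le_iff)
      qed
    qed
    moreover have "emeasure lborel (cbox l u) \<le> ennreal c * diam_power ?d s (U i)"
    proof -
      have "cbox l u \<noteq> {}" using a \<open>W i \<subseteq> cbox l u\<close> by blast
      then have "measure lborel (cbox l u) = (\<Prod>j\<in>UNIV. u $ j - l $ j)" by (rule content_cbox_cart)
      also have "\<dots> = (2 * \<rho>) ^ 2" by (simp add: l_def u_def)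
      also have "\<dots> = c * D i powr (2 * \<gamma>)"
      proof -
        have "D i powr (2 * \<gamma>) = (D i powr \<gamma>) ^ 2"
          by (simp add: power2_eq_square flip: powr_add)
        then show ?thesis using K(1) D by (simp add: \<rho>_def c_def powr_mult power_mult_distrib)
      qed
      finally have "emeasure lborel (cbox l u) = ennreal (c * D i powr (2 * \<gamma>))"
        using emeasure_lborel_cbox_finite[of l u] by (simp add: emeasure_eq_ennreal_measure)
      also have "\<dots> = ennreal c * ennreal (D i powr (2 * \<gamma>))" using \<open>c \<ge> 0\<close> by (simp add: ennreal_mult)
      also have "ennreal (D i powr (2 * \<gamma>)) \<le> diam_power ?d s (U i)"
      proof -
        have "U i \<noteq> {}" using a by (auto simp: W_def)
        moreover have "D i powr (2 * \<gamma>) \<le> 1" using D[of i] \<gamma> by (intro powr_le1) auto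
        moreover have "D i powr (2 * \<gamma>) \<le> D i powr s"
        proof (cases "D i = 0")
          case False
          then show ?thesis using D[of i] s by (intro powr_mono') auto
        qed (use \<gamma> in auto)
        ultimately show ?thesis
          by (auto simp: diam_power_def D_def intro!: ennreal_leI simp flip: ennreal_1)
      qed
      finally show ?thesis by (simp add: mult_left_mono)
    qed
    ultimately show ?thesis by (intro exI[of _ "cbox l u"]) auto
  qed (auto intro: exI[of _ "{}"])
  then obtain Q where Q: "\<And>i. Q i \<in> sets lborel" "\<And>i. W i \<subseteq> Q i"
      "\<And>i. emeasure lborel (Q i) \<le> ennreal c * diam_power ?d s (U i)"
    by metis
  have cover: "box 0 (\<chi> j. 1) \<subseteq> (\<Union>i. Q i)"
  proof
    fix x :: "real^2" assume "x \<in> box 0 (\<chi> j. 1)"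
    then have x: "x $ 1 \<in> {0..<1}" "x $ 2 \<in> {0..<1}" by (auto simp: mem_box_cart less_imp_le)
    then have "vector [h (x $ 1), h (x $ 2)] \<in> ?E" using h by auto
    then obtain i where "vector [h (x $ 1), h (x $ 2)] \<in> U i" using U(1) by blast
    then have "x \<in> W i" using x by (auto simp: W_def)
    then show "x \<in> (\<Union>i. Q i)" using Q(2) by blast
  qed
  have "1 = emeasure lborel (box 0 (\<chi> j. 1) :: (real^2) set)"
  proof -
    have "((\<chi> j. 1) :: real^2) \<bullet> b = 1" if "b \<in> (Basis :: (real^2) set)" for b
      using that by (auto simp: Basis_vec_def inner_axis)
    then show ?thesis by (simp add: emeasure_lborel_box_eq)
  qed
  also have "\<dots> \<le> emeasure lborel (\<Union>i. Q i)" using cover Q(1) by (intro emeasure_mono) auto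
  also have "\<dots> \<le> (\<Sum>i. emeasure lborel (Q i))" using Q(1) by (intro emeasure_subadditive_countably) auto
  also have "\<dots> \<le> (\<Sum>i. ennreal c * diam_power ?d s (U i))" by (intro suminf_le Q(3)) auto
  also have "\<dots> = ennreal c * (\<Sum>i. diam_power ?d s (U i))" by simp
  also have "\<dots> \<le> ennreal c * ennreal (1 / (c + 1))" using small by (intro mult_left_mono) auto
  also have "\<dots> = ennreal (c / (c + 1))" using \<open>c \<ge> 0\<close> by (simp flip: ennreal_mult)
  also have "\<dots> < ennreal 1" using \<open>c \<ge> 0\<close> by (intro ennreal_lessI) auto
  finally show False by simp
qed

text \<open>The dimension is the infimum of the exponents of measure zero: every exponent above 2 is
  one by the grid covers, and none below 2 is, by the Hoelder bound for a suitable
  \<open>\<gamma>\<close>.\<close>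

lemma hausdorff_dim_square_eq_2:
  fixes N :: "real ^ 2 \<Rightarrow> real" and A :: "real set" and h :: "real \<Rightarrow> real"
  assumes K: "K > 0" "\<And>x. norm x \<le> K * N x" "\<And>x. N x \<le> K * norm x"
    and "bounded A" and h: "\<forall>t\<in>{0..<1}. h t \<in> A"
    and hoelder: "\<forall>\<gamma>. 0 < \<gamma> \<longrightarrow> \<gamma> < 1 \<longrightarrow>
       (\<exists>G. \<forall>t\<in>{0..<1}. \<forall>t'\<in>{0..<1}. \<bar>t - t'\<bar> \<le> G * \<bar>h t - h t'\<bar> powr \<gamma>)"
  shows "hausdorff_dim (norm_dist N) {x. x $ 1 \<in> A \<and> x $ 2 \<in> A} = 2"
proof (rule antisym)
  let ?E = "{x :: real^2. x $ 1 \<in> A \<and> x $ 2 \<in> A}"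
  have "bounded ?E"
  proof -
    obtain R where R: "\<And>t. t \<in> A \<Longrightarrow> \<bar>t\<bar> \<le> R" using \<open>bounded A\<close> by (auto simp: bounded_iff)
    have "norm x \<le> 2 * R" if "x \<in> ?E" for x :: "real^2"
    proof -
      have "norm x \<le> (\<Sum>i\<in>UNIV. \<bar>x $ i\<bar>)" by (rule norm_le_l1_cart)
      also have "\<dots> \<le> 2 * R" using R[of "x $ 1"] R[of "x $ 2"] that by (simp add: sum_2)
      finally show ?thesis .
    qed
    then show ?thesis unfolding bounded_iff by blast
  qed
  then have "hausdorff_measure (norm_dist N) s ?E = 0" if "2 < s" for s
    using that K(1,3) by (intro hausdorff_measure_plane_eq_0[of _ K])
  then have le: "hausdorff_dim (norm_dist N) ?E \<le> ereal s" if "2 < s" for s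
    unfolding hausdorff_dim_def using that by (intro Inf_lower imageI) auto
  show "hausdorff_dim (norm_dist N) ?E \<le> 2"
  proof (rule dense_ge)
    fix x :: ereal assume "2 < x"
    then show "hausdorff_dim (norm_dist N) ?E \<le> x"
      using le by (cases x) auto
  qed
  show "2 \<le> hausdorff_dim (norm_dist N) ?E"
    unfolding hausdorff_dim_def
  proof (rule Inf_greatest, clarify)
    fix s :: real assume s: "0 \<le> s" "hausdorff_measure (norm_dist N) s ?E = 0"
    have "\<not> s < 2"
    proof
      assume "s < 2"
      \<comment> \<open>The value 1/2 keeps \<open>\<gamma>\<close> positive when
        \<open>s = 0\<close>.\<close>
      define \<gamma> where "\<gamma> = max (s / 2) (1 / 2)"
      have \<gamma>: "0 < \<gamma>" "\<gamma> < 1" "s \<le> 2 * \<gamma>" using \<open>s < 2\<close> by (auto simp: \<gamma>_def)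
      then obtain G where "\<forall>t\<in>{0..<1}. \<forall>t'\<in>{0..<1}. \<bar>t - t'\<bar> \<le> G * \<bar>h t - h t'\<bar> powr \<gamma>"
        using hoelder by blast
      from hausdorff_measure_square_neq_0[OF K(1,2) h this \<gamma>(1) s(1) \<gamma>(3)] s(2) show False by blast
    qed
    then show "2 \<le> ereal s" by simp
  qed
qed

section \<open>The product set and its distances\<close>

lemma negligible_scale_image:
  fixes D :: "real set"
  assumes "negligible D"
  shows "negligible ((\<lambda>z. c * z) ` D)"
  using assms by (intro negligible_differentiable_image_negligible) (auto intro!: derivative_intros)

theorem corollary3:
  fixes N :: "real ^ 2 \<Rightarrow> real"
  assumes "is_norm N"
    and "polytope (norm_unit_ball N)"
    and "\<And>F. F edge_of norm_unit_ball N \<Longrightarrow> \<exists>m. has_slope F m \<and> algebraic_slope m"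
  shows "\<exists>A :: (real ^ 2) set.
           compactin (Metric_space.mtopology UNIV (norm_dist N)) A \<and>
           hausdorff_dim (norm_dist N) A = 2 \<and>
           distance_set N A \<in> null_sets lebesgue"
proof -
  obtain K where K: "K > 0" "\<And>x. norm x \<le> K * N x" "\<And>x. N x \<le> K * norm x"
    using is_norm_equivalent_norm[OF assms(1) polytope_imp_bounded[OF assms(2)]] by blast
  define \<F> where "\<F> = {F. F edge_of norm_unit_ball N}"
  have "finite \<F>"
    using finite_polytope_faces[OF assms(2)] by (rule finite_subset[rotated]) (auto simp: \<F>_def edge_of_def)
  have "\<exists>s c. algebraic s \<and> (\<forall>x. x \<noteq> 0 \<longrightarrow> (1 / N x) *\<^sub>R x \<in> F \<longrightarrow>
      N x = c * x $ 1 \<or> N x = c * (x $ 2 - s * x $ 1))" if "F \<in> \<F>" for F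
  proof -
    have F: "F edge_of norm_unit_ball N" using that by (simp add: \<F>_def)
    obtain m where m: "has_slope F m" "algebraic_slope m" using assms(3)[OF F] by blast
    obtain c where c: "\<And>x. x \<noteq> 0 \<Longrightarrow> (1 / N x) *\<^sub>R x \<in> F \<Longrightarrow>
        N x = c * (if m = \<infinity> then x $ 1 else x $ 2 - real_of_ereal m * x $ 1)"
      using norm_on_edge_cone[OF assms(1,2) F m(1)] by blast
    show ?thesis
    proof (cases "m = \<infinity>")
      case True
      \<comment> \<open>On a vertical edge the first alternative holds, so any algebraic number can
        stand for \<open>s\<close>.\<close>
      have "algebraic (0::real)" by simp
      then show ?thesis using c True by (intro exI[of _ 0] exI[of _ c]) auto
    next
      case False
      then have "algebraic (real_of_ereal m)" using m(2) by (auto simp: algebraic_slope_def)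
      then show ?thesis using c False by (intro exI[of _ "real_of_ereal m"] exI[of _ c]) auto
    qed
  qed
  then have "\<forall>F\<in>\<F>. \<exists>sc. algebraic (fst sc) \<and> (\<forall>x. x \<noteq> 0 \<longrightarrow> (1 / N x) *\<^sub>R x \<in> F \<longrightarrow>
      N x = snd sc * x $ 1 \<or> N x = snd sc * (x $ 2 - fst sc * x $ 1))" by simp
  from bchoice[OF this] obtain sc where sc: "\<And>F. F \<in> \<F> \<Longrightarrow> algebraic (fst (sc F))"
    "\<And>F x. F \<in> \<F> \<Longrightarrow> x \<noteq> 0 \<Longrightarrow> (1 / N x) *\<^sub>R x \<in> F \<Longrightarrow>
       N x = snd (sc F) * x $ 1 \<or> N x = snd (sc F) * (x $ 2 - fst (sc F) * x $ 1)"
    by blast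
  \<comment> \<open>The 0 stands for vertical edges, where the distance is a multiple of a
    difference of first coordinates.\<close>
  define S where "S = insert 0 ((\<lambda>F. fst (sc F)) ` \<F>)"
  have "finite S" using \<open>finite \<F>\<close> by (simp add: S_def)
  moreover have "algebraic s" if "s \<in> S" for s using that sc(1) by (auto simp: S_def)
  ultimately obtain A h where A: "compact A" "\<forall>t\<in>{0..<1}. h t \<in> A"
    "\<forall>s\<in>S. negligible (dilated_differences s A)"
    "\<forall>\<gamma>. 0 < \<gamma> \<longrightarrow> \<gamma> < 1 \<longrightarrow>
       (\<exists>G. \<forall>t\<in>{0..<1}. \<forall>t'\<in>{0..<1}. \<bar>t - t'\<bar> \<le> G * \<bar>h t - h t'\<bar> powr \<gamma>)"
    by (rule algebraic_sparse_set_exists)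
  define E where "E = {x :: real^2. x $ 1 \<in> A \<and> x $ 2 \<in> A}"
  have dim: "hausdorff_dim (norm_dist N) E = 2"
    unfolding E_def by (rule hausdorff_dim_square_eq_2[OF K compact_imp_bounded[OF A(1)] A(2,4)])
  have "compact E"
  proof -
    let ?f = "\<lambda>p. fst p *\<^sub>R axis 1 1 + snd p *\<^sub>R axis 2 1 :: real^2"
    have "E = ?f ` (A \<times> A)"
    proof (intro equalityI subsetI)
      fix x assume "x \<in> E"
      moreover have "x = ?f (x $ 1, x $ 2)" using plane_axis_decomposition[of x] by simp
      ultimately show "x \<in> ?f ` (A \<times> A)" by (intro image_eqI[of _ _ "(x $ 1, x $ 2)"]) (auto simp: E_def)
    qed (auto simp: E_def axis_def)
    moreover have "continuous_on (A \<times> A) ?f" by (intro continuous_intros)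
    ultimately show ?thesis using A(1) by (simp add: compact_continuous_image compact_Times)
  qed
  then have comp: "compactin (Metric_space.mtopology UNIV (norm_dist N)) E"
    by (rule compactin_norm_dist[OF assms(1) K(3)])
  \<comment> \<open>Both shapes are included for every edge; 0 is the distance of a point to
    itself.\<close>
  define Z where "Z = insert 0 (\<Union>F\<in>\<F>. (\<lambda>z. snd (sc F) * z) ` dilated_differences 0 A \<union>
      (\<lambda>z. snd (sc F) * z) ` dilated_differences (fst (sc F)) A)"
  have "distance_set N E \<subseteq> Z"
  proof
    fix z assume "z \<in> distance_set N E"
    then obtain x y where xy: "x \<in> E" "y \<in> E" "z = N (x - y)" by (auto simp: distance_set_def)
    show "z \<in> Z"
    proof (cases "x = y")
      case True
      then show ?thesis using assms(1) xy(3) by (auto simp: Z_def is_norm_def)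
    next
      case False
      then have "x - y \<noteq> 0" by simp
      then obtain F where F: "F edge_of norm_unit_ball N" "(1 / N (x - y)) *\<^sub>R (x - y) \<in> F"
        by (rule radial_projection_in_edge[OF assms(1,2)])
      then have "F \<in> \<F>" by (simp add: \<F>_def)
      have "x $ 1 \<in> A" "x $ 2 \<in> A" "y $ 1 \<in> A" "y $ 2 \<in> A" using xy by (auto simp: E_def)
      \<comment> \<open>Swapping \<open>x\<close> and \<open>y\<close> in the first coordinate
        absorbs the minus sign before the slope; the summand with factor 0 gives the plain
        difference the required form.\<close>
      then have "(x $ 1 - y $ 1) + 0 * (x $ 1 - y $ 1) \<in> dilated_differences 0 A"
        "(x $ 2 - y $ 2) + fst (sc F) * (y $ 1 - x $ 1) \<in> dilated_differences (fst (sc F)) A"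
        by (blast intro: dilated_differencesI)+
      moreover have "z = snd (sc F) * ((x $ 1 - y $ 1) + 0 * (x $ 1 - y $ 1)) \<or>
          z = snd (sc F) * ((x $ 2 - y $ 2) + fst (sc F) * (y $ 1 - x $ 1))"
        using sc(2)[OF \<open>F \<in> \<F>\<close> \<open>x - y \<noteq> 0\<close> F(2)] by (auto simp: xy(3) algebra_simps)
      ultimately show ?thesis using \<open>F \<in> \<F>\<close> unfolding Z_def by blast
    qed
  qed
  moreover have "negligible Z"
  proof -
    have "negligible ((\<lambda>z. snd (sc F) * z) ` dilated_differences 0 A \<union>
        (\<lambda>z. snd (sc F) * z) ` dilated_differences (fst (sc F)) A)" if "F \<in> \<F>" for F
      using A(3) that by (intro negligible_Un negligible_scale_image) (auto simp: S_def)
    then have "negligible (\<Union>F\<in>\<F>. (\<lambda>z. snd (sc F) * z) ` dilated_differences 0 A \<union>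
        (\<lambda>z. snd (sc F) * z) ` dilated_differences (fst (sc F)) A)"
      using \<open>finite \<F>\<close> by (intro negligible_Union) auto
    then show ?thesis by (simp add: Z_def negligible_insert)
  qed
  ultimately have "negligible (distance_set N E)" by (rule negligible_subset[rotated])
  then have "distance_set N E \<in> null_sets lebesgue" by (simp add: negligible_iff_null_sets)
  with comp dim show ?thesis by blast
qed

end
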